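(* Let $(\Omega,\mathcal F)$ be a measurable space, $\mathfrak P$ a nonempty set of probability measures on it, and $\Phi=(\phi_{\mathbb P})_{\mathbb P\in\mathfrak P}$ a family of Orlicz functions. The following statements are equivalent: (1) $L^\infty(\mathfrak P)\subset L^\Phi(\mathfrak P)$. (2) There is a set of probability measures $\mathfrak R\subset\mathbf{ca}_+^1(L^\Phi(\mathfrak P))$ and a family $\Psi=(\psi_{\mathbb Q})_{\mathbb Q\in\mathfrak R}$ of Orlicz functions such that $\mathfrak R\approx\mathfrak P$ and $L^\Phi(\mathfrak P)=\mathfrak L^\Psi(\mathfrak R)$. In particular, if $\mathfrak P$ is countably convex and there exist constants $(c_{\mathbb P})_{\mathbb P\in\mathfrak P}\subset(0,\infty)$ such that $$\phi_{\mathrm{Max}}(x)\le\phi_{\mathbb P}(c_{\mathbb P}x)\quad\text{for all }x\ge0\text{ and }\mathbb P\in\mathfrak P,$$ then (1) and (2) hold and one can choose $\mathfrak R=\mathfrak P$ as well as $\Psi=\Phi$ or $\Psi=(\phi_{\mathrm{Max}})_{\mathbb P\in\mathfrak P}$.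
   Context: $L^0(\mathfrak P)$ is the space of equivalence classes $[f]$ of measurable functions $f\colon\Omega\to\mathbb R$ under $f\sim g\iff \mathbb P(f=g)=1$ for all $\mathbb P\in\mathfrak P$. $L^\infty(\mathfrak P)\subset L^0(\mathfrak P)$ is the space of classes of bounded random variables. An Orlicz function is a lower semicontinuous, nondecreasing, convex function $\phi\colon[0,\infty)\to[0,\infty]$ with $\phi(0)=0$ such that there are $x_0,x_1>0$ with $\phi(x_0)<\infty$ and $\phi(x_1)>0$. Put $\phi_{\mathrm{Max}}(x)=\sup_{\mathbb P\in\mathfrak P}\phi_{\mathbb P}(x)$, $x\ge0$. For $X\in L^0(\mathfrak P)$, $$\|X\|_{L^\Phi(\mathfrak P)}=\inf\Big\{\lambda>0:\ \sup_{\mathbb P\in\mathfrak P}\mathbb E_{\mathbb P}[\phi_{\mathbb P}(\lambda^{-1}|X|)]\le1\Big\}\in[0,\infty],$$ and $L^\Phi(\mathfrak P)=\{X\in L^0(\mathfrak P): \|X\|_{L^\Phi(\mathfrak P)}<\infty\}$. For a nonempty set $\mathfrak R$ of probability measures and a family $\Psi=(\psi_{\mathbb Q})_{\mathbb Q\in\mathfrak R}$ of Orlicz functions, $$\mathfrak L^\Psi(\mathfrak R)=\{X\in L^0(\mathfrak R):\ \forall\,\mathbb Q\in\mathfrak R\ \exists\,\alpha>0:\ \mathbb E_{\mathbb Q}[\psi_{\mathbb Q}(\alpha|X|)]<\infty\}.$$ $\mathbf{ca}(\mathfrak P)$ is the set of signed measures $\mu$ on $(\Omega,\mathcal F)$ of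 finite total variation such that $|\mu|(N)=0$ for every $N\in\mathcal F$ with $\sup_{\mathbb P\in\mathfrak P}\mathbb P(N)=0$. $\mathbf{ca}(L^\Phi(\mathfrak P))$ is the set of $\mu\in\mathbf{ca}(\mathfrak P)$ such that every $X\in L^\Phi(\mathfrak P)$ is $|\mu|$-integrable and $X\mapsto\int X\,d|\mu|$ is norm continuous on $L^\Phi(\mathfrak P)$; $\mathbf{ca}_+^1(L^\Phi(\mathfrak P))$ is the set of probability measures in it. $\mathfrak R\approx\mathfrak P$ means that for $N\in\mathcal F$, $\sup_{\mathbb Q\in\mathfrak R}\mathbb Q(N)=0$ iff $\sup_{\mathbb P\in\mathfrak P}\mathbb P(N)=0$; in that case $L^0(\mathfrak R)=L^0(\mathfrak P)$. $\mathfrak P$ is countably convex if $\sum_n\lambda_n\mathbb P_n\in\mathfrak P$ for all sequences $(\mathbb P_n)_{n\in\mathbb N}\subset\mathfrak P$ and $\lambda_n\ge0$ with $\sum_n\lambda_n=1$. *)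

theory Defs
  imports "HOL-Probability.Probability"
begin

text \<open>
  The measurable space \<open>(\<Omega>, \<F>)\<close> is given by \<open>space M\<close> and \<open>sets M\<close>; the measure carried by
  \<open>M\<close> plays no role. Sets of probability measures on it are subsets of \<open>space (prob_algebra M)\<close>.
  A function \<open>[0,\<infinity>) \<rightarrow> [0,\<infinity>]\<close> is a term of type \<^typ>\<open>real \<Rightarrow> ennreal\<close>, only ever evaluated at
  nonnegative arguments, and families indexed by measures are functions on \<^typ>\<open>'a measure\<close> of
  which only the values on the index set matter.
\<close>

definition orlicz_function :: "(real \<Rightarrow> ennreal) \<Rightarrow> bool" where
  "orlicz_function \<phi> \<longleftrightarrow>
     (\<forall>x\<ge>0. \<phi> x \<le> Liminf (at x within {0..}) \<phi>) \<and>
     mono_on {0..} \<phi> \<and>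
     (\<forall>x\<ge>0. \<forall>y\<ge>0. \<forall>t\<in>{0..1}.
        \<phi> ((1 - t) * x + t * y) \<le> ennreal (1 - t) * \<phi> x + ennreal t * \<phi> y) \<and>
     \<phi> 0 = 0 \<and>
     (\<exists>x>0. \<phi> x < \<infinity>) \<and> (\<exists>x>0. \<phi> x > 0)"

definition phi_Max :: "'a measure set \<Rightarrow> ('a measure \<Rightarrow> real \<Rightarrow> ennreal) \<Rightarrow> real \<Rightarrow> ennreal" where
  "phi_Max \<PP> \<Phi> x = (SUP P\<in>\<PP>. \<Phi> P x)"

definition qs_rel :: "'a measure \<Rightarrow> 'a measure set \<Rightarrow> (('a \<Rightarrow> real) \<times> ('a \<Rightarrow> real)) set" where
  "qs_rel M \<PP> = {(f, g). f \<in> borel_measurable M \<and> g \<in> borel_measurable M \<and>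
                    (\<forall>P\<in>\<PP>. \<P>(\<omega> in P. f \<omega> = g \<omega>) = 1)}"

definition L0 :: "'a measure \<Rightarrow> 'a measure set \<Rightarrow> ('a \<Rightarrow> real) set set" where
  "L0 M \<PP> = borel_measurable M // qs_rel M \<PP>"

definition Linf :: "'a measure \<Rightarrow> 'a measure set \<Rightarrow> ('a \<Rightarrow> real) set set" where
  "Linf M \<PP> = {X \<in> L0 M \<PP>. \<exists>f\<in>X. \<exists>c. \<forall>\<omega>\<in>space M. \<bar>f \<omega>\<bar> \<le> c}"

text \<open>
  Norm, expectations and integrals are defined on functions. They are constant on equivalence
  classes, and statements about a class \<open>X\<close> are expressed by quantifying over all representatives.
\<close>

definition orlicz_norm ::
  "'a measure set \<Rightarrow> ('a measure \<Rightarrow> real \<Rightarrow> ennreal) \<Rightarrow> ('a \<Rightarrow> real) \<Rightarrow> ennreal" where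
  "orlicz_norm \<PP> \<Phi> f =
     Inf {ennreal l | l. l > 0 \<and> (SUP P\<in>\<PP>. \<integral>\<^sup>+\<omega>. \<Phi> P (inverse l * \<bar>f \<omega>\<bar>) \<partial>P) \<le> 1}"

definition L_Phi ::
  "'a measure \<Rightarrow> 'a measure set \<Rightarrow> ('a measure \<Rightarrow> real \<Rightarrow> ennreal) \<Rightarrow> ('a \<Rightarrow> real) set set" where
  "L_Phi M \<PP> \<Phi> = {X \<in> L0 M \<PP>. \<forall>f\<in>X. orlicz_norm \<PP> \<Phi> f < \<infinity>}"

definition frak_L ::
  "'a measure \<Rightarrow> 'a measure set \<Rightarrow> ('a measure \<Rightarrow> real \<Rightarrow> ennreal) \<Rightarrow> ('a \<Rightarrow> real) set set" where
  "frak_L M \<RR> \<Psi> =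
     {X \<in> L0 M \<RR>. \<forall>f\<in>X. \<forall>Q\<in>\<RR>. \<exists>\<alpha>>0. (\<integral>\<^sup>+\<omega>. \<Psi> Q (\<alpha> * \<bar>f \<omega>\<bar>) \<partial>Q) < \<infinity>}"

text \<open>
  Signed measures are real-valued set functions, extended by \<open>0\<close> outside the sigma-algebra so that
  each of them is represented by exactly one function; \<open>measure Q\<close> follows the same convention.
\<close>

definition signed_measure :: "'a measure \<Rightarrow> ('a set \<Rightarrow> real) \<Rightarrow> bool" where
  "signed_measure M \<mu> \<longleftrightarrow>
     \<mu> {} = 0 \<and>
     (\<forall>A::nat \<Rightarrow> 'a set. range A \<subseteq> sets M \<longrightarrow> disjoint_family A \<longrightarrow>
        (\<lambda>i. \<mu> (A i)) sums \<mu> (\<Union>i. A i)) \<and>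
     (\<forall>A. A \<notin> sets M \<longrightarrow> \<mu> A = 0)"

definition variation :: "'a measure \<Rightarrow> ('a set \<Rightarrow> real) \<Rightarrow> 'a measure" where
  "variation M \<mu> = measure_of (space M) (sets M)
     (\<lambda>A. SUP \<pi>\<in>{\<pi>. finite \<pi> \<and> \<pi> \<subseteq> sets M \<and> partition_on A \<pi>}. ennreal (\<Sum>B\<in>\<pi>. \<bar>\<mu> B\<bar>))"

definition ca :: "'a measure \<Rightarrow> 'a measure set \<Rightarrow> ('a set \<Rightarrow> real) set" where
  "ca M \<PP> = {\<mu>. signed_measure M \<mu> \<and> emeasure (variation M \<mu>) (space M) < \<infinity> \<and>
     (\<forall>N\<in>sets M. (SUP P\<in>\<PP>. emeasure P N) = 0 \<longrightarrow> emeasure (variation M \<mu>) N = 0)}"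

definition ca_L_Phi ::
  "'a measure \<Rightarrow> 'a measure set \<Rightarrow> ('a measure \<Rightarrow> real \<Rightarrow> ennreal) \<Rightarrow> ('a set \<Rightarrow> real) set" where
  "ca_L_Phi M \<PP> \<Phi> = {\<mu> \<in> ca M \<PP>.
     (\<forall>X\<in>L_Phi M \<PP> \<Phi>. \<forall>f\<in>X. integrable (variation M \<mu>) f) \<and>
     (\<forall>X\<in>L_Phi M \<PP> \<Phi>. \<forall>f\<in>X. \<forall>\<epsilon>>0. \<exists>\<delta>>0. \<forall>Y\<in>L_Phi M \<PP> \<Phi>. \<forall>g\<in>Y.
        orlicz_norm \<PP> \<Phi> (\<lambda>\<omega>. g \<omega> - f \<omega>) < ennreal \<delta> \<longrightarrow>
        \<bar>(\<integral>\<omega>. g \<omega> \<partial>variation M \<mu>) - (\<integral>\<omega>. f \<omega> \<partial>variation M \<mu>)\<bar> < \<epsilon>)}"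

definition ca_plus_1 ::
  "'a measure \<Rightarrow> 'a measure set \<Rightarrow> ('a measure \<Rightarrow> real \<Rightarrow> ennreal) \<Rightarrow> 'a measure set" where
  "ca_plus_1 M \<PP> \<Phi> = {Q \<in> space (prob_algebra M). measure Q \<in> ca_L_Phi M \<PP> \<Phi>}"

definition equiv_measures :: "'a measure \<Rightarrow> 'a measure set \<Rightarrow> 'a measure set \<Rightarrow> bool" where
  "equiv_measures M \<RR> \<PP> \<longleftrightarrow>
     (\<forall>N\<in>sets M. (SUP Q\<in>\<RR>. emeasure Q N) = 0 \<longleftrightarrow> (SUP P\<in>\<PP>. emeasure P N) = 0)"

definition mixture :: "'a measure \<Rightarrow> (nat \<Rightarrow> real) \<Rightarrow> (nat \<Rightarrow> 'a measure) \<Rightarrow> 'a measure" where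
  "mixture M l P = measure_of (space M) (sets M) (\<lambda>A. \<Sum>n. ennreal (l n) * emeasure (P n) A)"

definition countably_convex :: "'a measure \<Rightarrow> 'a measure set \<Rightarrow> bool" where
  "countably_convex M \<PP> \<longleftrightarrow>
     (\<forall>P l. range P \<subseteq> \<PP> \<longrightarrow> (\<forall>n. l n \<ge> 0) \<longrightarrow> l sums 1 \<longrightarrow> mixture M l P \<in> \<PP>)"

definition represents_L_Phi ::
  "'a measure \<Rightarrow> 'a measure set \<Rightarrow> ('a measure \<Rightarrow> real \<Rightarrow> ennreal) \<Rightarrow>
   'a measure set \<Rightarrow> ('a measure \<Rightarrow> real \<Rightarrow> ennreal) \<Rightarrow> bool" where
  "represents_L_Phi M \<PP> \<Phi> \<RR> \<Psi> \<longleftrightarrow>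
     \<RR> \<noteq> {} \<and> \<RR> \<subseteq> ca_plus_1 M \<PP> \<Phi> \<and> (\<forall>Q\<in>\<RR>. orlicz_function (\<Psi> Q)) \<and>
     equiv_measures M \<RR> \<PP> \<and> L_Phi M \<PP> \<Phi> = frak_L M \<RR> \<Psi>"

end

theory Submission
  imports Defs
begin

text \<open>
  If \<open>L\<^sup>\<infinity> \<subseteq> L\<^sup>\<Phi>\<close>, one can take for \<open>\<RR>\<close> all probability measures in \<open>ca(L\<^sup>\<Phi>)\<close> and \<open>\<psi>\<^sub>Q(x) = x\<close>.
  An Orlicz function dominates a nonconstant affine function, so \<open>\<PP> \<subseteq> \<RR>\<close>. If \<open>X\<close> has infinite norm, then
  for every \<open>k\<close> there is \<open>P\<^sub>k\<close> with \<open>E[\<phi>(|X| / 4^k)] > 1\<close> under \<open>P\<^sub>k\<close>; supporting lines of \<open>\<phi>\<close> at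
  \<open>|X| / 4^k\<close> give a density \<open>u\<^sub>k\<close> in the dual unit ball that integrates \<open>|X|\<close> to at least \<open>4^k\<close>. The
  mixture of the measures \<open>u\<^sub>k P\<^sub>k\<close> with weights \<open>2^-(k+1)\<close> has finite mass because constants lie in
  \<open>L\<^sup>\<Phi>\<close>, and it does not integrate \<open>|X|\<close>.

  In the countably convex case, the mixture \<open>Q\<close> of the \<open>P\<^sub>k\<close> themselves lies in \<open>\<PP>\<close>. Integrability of
  \<open>\<phi>\<^sub>Q(\<alpha>|X|)\<close> under \<open>Q\<close> bounds the integral of \<open>\<phi>(\<beta>|X|)\<close> under \<open>P\<^sub>k\<close> by a multiple of \<open>2^k\<close>,
  and convexity turns this into a contradiction at scale \<open>4^k\<close>.
\<close>

subsection \<open>Orlicz functions\<close>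

text \<open>At \<open>x\<close> itself \<phi> may reach the edge of its finiteness domain with
  infinite slope, so the supporting line is taken at a nearby \<open>y < x\<close> where lower
  semicontinuity still gives \<open>t < \<phi> y\<close>. Monotonicity makes its slope nonnegative,
  so its value at \<open>x\<close> also exceeds \<open>t\<close>. Truncation by
  \<open>ennreal\<close> replaces each line by its positive part.\<close>

lemma orlicz_affine_minorant:
  assumes \<phi>: "orlicz_function \<phi>" and x: "0 \<le> x" and t: "t < \<phi> x"
  obtains a b :: real where "0 \<le> a" "0 \<le> b" "t < ennreal (a * x - b)"
    "\<And>z. 0 \<le> z \<Longrightarrow> ennreal (a * z - b) \<le> \<phi> z"
proof -
  have mono: "\<phi> u \<le> \<phi> v" if "0 \<le> u" "u \<le> v" for u v
    using \<phi> that by (auto simp: orlicz_function_def intro: mono_onD)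
  have zero: "\<phi> 0 = 0" using \<phi> by (simp add: orlicz_function_def)
  have x_pos: "0 < x" using x t zero by (cases "x = 0") auto
  have "\<forall>\<^sub>F y in at x within {0..}. t < \<phi> y"
  proof -
    have "\<phi> x \<le> Liminf (at x within {0..}) \<phi>"
      using \<phi> x by (simp add: orlicz_function_def)
    then show ?thesis using t by (simp add: le_Liminf_iff)
  qed
  then obtain d where d: "d > 0" "\<And>y. \<lbrakk>0 \<le> y; y \<noteq> x; dist y x < d\<rbrakk> \<Longrightarrow> t < \<phi> y"
    by (auto simp: eventually_at)
  \<comment> \<open>\<open>x / 2\<close> keeps \<open>y\<close> positive; \<open>x - d / 2\<close>
    keeps it in the neighbourhood of \<open>x\<close> on which \<phi> exceeds
    \<open>t\<close>.\<close>
  define y where "y = max (x / 2) (x - d / 2)"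
  have y: "0 < y" "y < x" "t < \<phi> y"
    using d x_pos by (auto simp: y_def dist_real_def intro!: d(2))
  \<comment> \<open>If \<phi> is finite at \<open>w\<close>, then \<open>y\<close> is interior to
    the finiteness domain; otherwise \<phi> is infinite from \<open>w\<close> on.\<close>
  define w where "w = (y + x) / 2"
  have w: "y < w" "w < x" "0 < w" using y by (auto simp: w_def)
  show thesis
  proof (cases "\<phi> w = \<infinity>")
    case True
    obtain T where T: "t = ennreal T" "0 \<le> T"
      using t by (cases t) auto
    \<comment> \<open>The slope of the line that vanishes at \<open>w\<close> and equals
      \<open>T + 1\<close> at \<open>x\<close>. The line is nonpositive up to \<open>w\<close>, and
      \<phi> is infinite beyond.\<close>
    define a where "a = (T + 1) / (x - w)"
    have a: "0 \<le> a" using T w by (simp add: a_def)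
    have eq: "a * x - a * w = T + 1"
    proof -
      have "a * x - a * w = a * (x - w)" by (simp add: algebra_simps)
      also have "\<dots> = T + 1" using w by (simp add: a_def)
      finally show ?thesis .
    qed
    show thesis
    proof (rule that[of a "a * w"])
      show "t < ennreal (a * x - a * w)" unfolding eq using T by (simp add: ennreal_less_iff)
      fix z :: real assume z: "0 \<le> z"
      show "ennreal (a * z - a * w) \<le> \<phi> z"
      proof (cases "z \<le> w")
        case True
        then have "a * z \<le> a * w" using a by (rule mult_left_mono)
        then show ?thesis by (simp add: ennreal_neg)
      next
        case False
        then have "\<phi> z = \<infinity>" using mono[of w z] w \<open>\<phi> w = \<infinity>\<close> by (simp add: top.extremum_uniqueI)
        then show ?thesis by simp
      qed
    qed (use a w in auto)
  next
    case False
    define I where "I = {z. 0 \<le> z \<and> \<phi> z < \<infinity>}"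
    define f where "f z = enn2real (\<phi> z)" for z
    have f: "\<phi> z = ennreal (f z)" if "z \<in> I" for z
      using that by (simp add: f_def I_def)
    have f_nonneg: "0 \<le> f z" for z by (simp add: f_def)
    have conv: "\<phi> ((1 - s) * u + s * v) \<le> ennreal ((1 - s) * f u + s * f v)"
      if "u \<in> I" "v \<in> I" "0 \<le> s" "s \<le> 1" for u v s
    proof -
      have "\<phi> ((1 - s) * u + s * v) \<le> ennreal (1 - s) * \<phi> u + ennreal s * \<phi> v"
        using \<phi> that by (auto simp: orlicz_function_def I_def)
      also have "\<dots> = ennreal ((1 - s) * f u + s * f v)"
        using that f_nonneg by (simp add: f ennreal_mult ennreal_plus)
      finally show ?thesis .
    qed
    have I_conv: "(1 - s) * u + s * v \<in> I" if "u \<in> I" "v \<in> I" "0 \<le> s" "s \<le> 1" for u v s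
    proof -
      have "\<phi> ((1 - s) * u + s * v) < \<infinity>"
        using conv[OF that] by (rule le_less_trans) simp
      then show ?thesis using that by (simp add: I_def)
    qed
    have "convex I"
      unfolding convex_alt using I_conv by auto
    have "convex_on I f"
    proof (rule convex_onI[OF _ \<open>convex I\<close>])
      fix s u v :: real assume s: "0 < s" "s < 1" and uv: "u \<in> I" "v \<in> I"
      have "ennreal (f ((1 - s) * u + s * v)) \<le> ennreal ((1 - s) * f u + s * f v)"
        using conv[OF uv, of s] f[OF I_conv[OF uv, of s]] s by simp
      then show "f ((1 - s) *\<^sub>R u + s *\<^sub>R v) \<le> (1 - s) * f u + s * f v"
        using s f_nonneg by (subst (asm) ennreal_le_iff) auto
    qed
    have wI: "w \<in> I" using False w by (simp add: I_def top.not_eq_extremum)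
    have sub: "{0..w} \<subseteq> I"
    proof
      fix z assume "z \<in> {0..w}"
      then have "0 \<le> z" "\<phi> z \<le> \<phi> w" by (auto intro: mono)
      then show "z \<in> I" using wI by (auto simp: I_def dest: le_less_trans)
    qed
    have "{0<..<w} \<subseteq> interior I"
      using sub by (intro interior_maximal) auto
    then have y_int: "y \<in> interior I" using y w by auto
    \<comment> \<open>The right derivative of \<open>f\<close> at \<open>y\<close>, as the infimum
      of the difference quotients to the right.\<close>
    define a where "a = Inf ((\<lambda>u. (f y - f u) / (y - u)) ` ({y<..} \<inter> I))"
    have supp: "f y + a * (z - y) \<le> f z" if "z \<in> I" for z
      using convex_le_Inf_differential[OF \<open>convex_on I f\<close> y_int that] by (simp add: a_def)
    have yI: "y \<in> I" using sub y w by auto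
    have f_mono: "f u \<le> f v" if "v \<in> I" "0 \<le> u" "u \<le> v" for u v
      unfolding f_def using mono[of u v] that by (intro enn2real_mono) (simp_all add: I_def)
    have a: "0 \<le> a" unfolding a_def
    proof (rule cInf_greatest)
      show "(\<lambda>u. (f y - f u) / (y - u)) ` ({y<..} \<inter> I) \<noteq> {}" using wI w by auto
      fix q assume "q \<in> (\<lambda>u. (f y - f u) / (y - u)) ` ({y<..} \<inter> I)"
      then obtain u where "u \<in> I" "y < u" "q = (f y - f u) / (y - u)" by auto
      then show "0 \<le> q" using f_mono[of u y] y by (auto simp: divide_nonpos_neg)
    qed
    \<comment> \<open>At \<open>0\<close>, where \<open>f\<close> vanishes, the supporting line is
      at most 0, so its intercept is nonpositive.\<close>
    have "0 \<in> I" using zero by (simp add: I_def)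
    then have b: "0 \<le> a * y - f y" using supp[of 0] zero by (simp add: f_def)
    show thesis
    proof (rule that[of a "a * y - f y"])
      have "f y \<le> a * x - (a * y - f y)"
        using a y mult_left_mono[of y x a] by simp
      then show "t < ennreal (a * x - (a * y - f y))"
        using y(3) unfolding f[OF yI] by (meson ennreal_leI less_le_trans)
      fix z :: real assume z: "0 \<le> z"
      show "ennreal (a * z - (a * y - f y)) \<le> \<phi> z"
      proof (cases "z \<in> I")
        case True
        then show ?thesis using supp[of z] by (auto simp: f algebra_simps intro!: ennreal_leI)
      next
        case False
        then show ?thesis using z by (simp add: I_def not_less top_unique)
      qed
    qed (use a b in auto)
  qed
qed

text \<open>Affine minorants with rational coefficients come arbitrarily close to those of the
  preceding lemma, and they form a countable family. Index \<open>0\<close> is reserved for the zero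
  minorant, so that running maxima of the family are nonnegative.\<close>

lemma orlicz_SUP_affine:
  assumes \<phi>: "orlicz_function \<phi>"
  shows "\<exists>a b :: nat \<Rightarrow> real. a 0 = 0 \<and> b 0 = 0 \<and> (\<forall>i. 0 \<le> a i) \<and> (\<forall>i. 0 \<le> b i) \<and>
    (\<forall>x\<ge>0. \<phi> x = (SUP i. ennreal (a i * x - b i)))"
proof -
  define D where "D = {(a, b). a \<in> \<rat> \<and> b \<in> \<rat> \<and> 0 \<le> a \<and> 0 \<le> b \<and>
    (\<forall>z\<ge>0. ennreal (a * z - b) \<le> \<phi> z)}"
  have "countable D"
    by (rule countable_subset[of _ "\<rat> \<times> \<rat>"]) (auto simp: D_def countable_rat)
  have D0: "(0, 0) \<in> D" by (auto simp: D_def)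
  \<comment> \<open>The enumeration of \<open>D\<close> is shifted by one to leave index
    \<open>0\<close> to the zero minorant.\<close>
  define c where "c = case_nat (0, 0) (from_nat_into D)"
  have c_in: "c i \<in> D" for i
    using D0 by (cases i) (auto simp: c_def intro: from_nat_into)
  have c_onto: "\<exists>i. c i = p" if "p \<in> D" for p
    using from_nat_into_surj[OF \<open>countable D\<close> that] by (auto simp: c_def intro: exI[of _ "Suc _"])
  have le: "ennreal (fst (c i) * x - snd (c i)) \<le> \<phi> x" if "0 \<le> x" for i x
    using c_in[of i] that by (auto simp: D_def)
  have "\<phi> x \<le> (SUP i. ennreal (fst (c i) * x - snd (c i)))" if x: "0 \<le> x" for x
  proof (rule dense_le)
    fix t assume "t < \<phi> x"
    then obtain a b where ab: "0 \<le> a" "0 \<le> b" "t < ennreal (a * x - b)"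
      "\<And>z. 0 \<le> z \<Longrightarrow> ennreal (a * z - b) \<le> \<phi> z"
      using orlicz_affine_minorant[OF \<phi> x] by blast
    obtain T where T: "t = ennreal T" "0 \<le> T"
      using ab(3) by (cases t) auto
    have gap: "T < a * x - b" using ab(3) T by (simp add: ennreal_less_iff)
    then have "0 < a * x" using T ab by linarith
    then have pos: "0 < a" "0 < x" using ab x by (auto simp: zero_less_mult_iff)
    \<comment> \<open>The slack above \<open>T\<close> at \<open>x\<close> is split: the slope drops
      by less than \<open>e / (2 * x)\<close> and the subtracted constant grows by less than
      \<open>e / 2\<close>. Both changes lower the line on the half-line, so it stays below \<phi>,
      and at \<open>x\<close> it loses less than \<open>e\<close>.\<close>
    define e where "e = a * x - b - T"
    have e: "0 < e" using gap by (simp add: e_def)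
    obtain a' where a': "a' \<in> \<rat>" "max 0 (a - e / (2 * x)) < a'" "a' < a"
      using Rats_dense_in_real[of "max 0 (a - e / (2 * x))" a] pos e by auto
    obtain b' where b': "b' \<in> \<rat>" "b < b'" "b' < b + e / 2"
      using Rats_dense_in_real[of b "b + e / 2"] e by auto
    have "(a', b') \<in> D"
    proof -
      have "ennreal (a' * z - b') \<le> \<phi> z" if z: "0 \<le> z" for z
      proof -
        have "a' * z - b' \<le> a * z - b" using a' b' z mult_right_mono[of a' a z] by simp
        then show ?thesis using ab(4)[OF z] by (meson ennreal_leI order_trans)
      qed
      then show ?thesis using a' b' ab by (auto simp: D_def)
    qed
    then obtain i where i: "c i = (a', b')" using c_onto by blast
    have "(a - e / (2 * x)) * x \<le> a' * x" using a' pos by (intro mult_right_mono) auto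
    then have "a * x - e / 2 \<le> a' * x" using pos by (simp add: algebra_simps)
    moreover have "T = a * x - b - e" by (simp add: e_def)
    ultimately have "T \<le> a' * x - b'" using b' e by argo
    then have "t \<le> ennreal (fst (c i) * x - snd (c i))" using T i by (auto intro: ennreal_leI)
    then show "t \<le> (SUP i. ennreal (fst (c i) * x - snd (c i)))"
      by (meson SUP_upper2 UNIV_I)
  qed
  then have "\<phi> x = (SUP i. ennreal (fst (c i) * x - snd (c i)))" if "0 \<le> x" for x
    using le that by (intro antisym SUP_least) auto
  moreover have "fst (c 0) = 0" "snd (c 0) = 0" by (auto simp: c_def)
  moreover have "0 \<le> fst (c i)" "0 \<le> snd (c i)" for i using c_in[of i] by (auto simp: D_def)
  ultimately show ?thesis
    by (intro exI[of _ "\<lambda>i. fst (c i)"] exI[of _ "\<lambda>i. snd (c i)"]) auto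
qed

text \<open>A countable supremum of Borel functions is Borel; the absolute value confines \<phi> to
  the half-line on which it is specified.\<close>

lemma borel_measurable_orlicz:
  assumes "orlicz_function \<phi>"
  shows "(\<lambda>x. \<phi> \<bar>x\<bar>) \<in> borel_measurable borel"
proof -
  obtain a b :: "nat \<Rightarrow> real" where "\<And>x. 0 \<le> x \<Longrightarrow> \<phi> x = (SUP i. ennreal (a i * x - b i))"
    using orlicz_SUP_affine[OF assms] by blast
  then have "(\<lambda>x. \<phi> \<bar>x\<bar>) = (\<lambda>x. SUP i. ennreal (a i * \<bar>x\<bar> - b i))" by auto
  then show ?thesis by simp
qed

text \<open>Young's inequality with near-equality along \<open>f\<close>: if \<open>A z - B\<close>
  is an affine minorant chosen to be large at \<open>|f|\<close>, then \<open>A z\<close> is at most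
  \<open>\<phi> z + B\<close> for every \<open>z\<close>, while \<open>A |f|\<close> is the value of
  the minorant plus \<open>B\<close>. Division by \<open>1 + E[B]\<close> bounds the pairing by 1 on
  the modular unit ball and keeps it at least 1 on \<open>f\<close>, where the minorant integrates
  to more than 1.\<close>

lemma orlicz_dual_density:
  assumes "prob_space P" and \<phi>: "orlicz_function \<phi>" and f[measurable]: "f \<in> borel_measurable P"
    and gt: "1 < (\<integral>\<^sup>+\<omega>. \<phi> \<bar>f \<omega>\<bar> \<partial>P)"
  obtains u :: "'a \<Rightarrow> ennreal" where "u \<in> borel_measurable P"
    "\<And>g. \<lbrakk>g \<in> borel_measurable P; (\<integral>\<^sup>+\<omega>. \<phi> \<bar>g \<omega>\<bar> \<partial>P) \<le> 1\<rbrakk> \<Longrightarrow> (\<integral>\<^sup>+\<omega>. u \<omega> * ennreal \<bar>g \<omega>\<bar> \<partial>P) \<le> 1"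
    "1 \<le> (\<integral>\<^sup>+\<omega>. u \<omega> * ennreal \<bar>f \<omega>\<bar> \<partial>P)"
proof -
  interpret prob_space P by fact
  obtain a b :: "nat \<Rightarrow> real" where ab: "a 0 = 0" "b 0 = 0" "\<And>i. 0 \<le> a i" "\<And>i. 0 \<le> b i"
    and sup: "\<And>x. 0 \<le> x \<Longrightarrow> \<phi> x = (SUP i. ennreal (a i * x - b i))"
    using orlicz_SUP_affine[OF \<phi>] by blast
  define v where "v i x = a i * x - b i" for i x
  \<comment> \<open>\<open>idx n x\<close> selects a maximal affine minorant at \<open>x\<close> among the first \<open>n + 1\<close>; a fixed \<open>n\<close> keeps
    slopes and intercepts bounded, and the slope along \<open>|f|\<close> is the density, up to normalisation.\<close>
  define idx :: "nat \<Rightarrow> real \<Rightarrow> nat" where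
    "idx n x = rec_nat 0 (\<lambda>i j. if v j x < v (Suc i) x then Suc i else j) n" for n x
  have idx_0: "idx 0 x = 0" and idx_Suc:
    "idx (Suc n) x = (if v (idx n x) x < v (Suc n) x then Suc n else idx n x)" for n x
    by (simp_all add: idx_def)
  have idx_meas[measurable]: "idx n \<in> borel \<rightarrow>\<^sub>M count_space UNIV" for n
  proof (induction n)
    case 0
    then show ?case by (simp add: idx_0 cong: measurable_cong)
  next
    case (Suc n)
    note [measurable] = this
    show ?case unfolding idx_Suc v_def by measurable
  qed
  have idx_le: "idx n x \<le> n" for n x
    by (induction n) (auto simp: idx_0 idx_Suc)
  have idx_max: "v i x \<le> v (idx n x) x" if "i \<le> n" for i n x
    using that
  proof (induction n)
    case (Suc n)
    then show ?case by (cases "i = Suc n") (fastforce simp: idx_Suc)+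
  qed (simp add: idx_0)
  have v_nonneg: "0 \<le> v (idx n x) x" for n x
    using idx_max[of 0 n x] ab by (simp add: v_def)
  have v_le: "ennreal (v i x) \<le> \<phi> x" if "0 \<le> x" for i x
    unfolding sup[OF that] v_def by (rule SUP_upper) simp
  have phi_eq: "\<phi> x = (SUP n. ennreal (v (idx n x) x))" if x: "0 \<le> x" for x
  proof (rule antisym)
    show "\<phi> x \<le> (SUP n. ennreal (v (idx n x) x))"
      unfolding sup[OF x]
      by (intro SUP_mono) (auto intro!: ennreal_leI idx_max simp: v_def[symmetric])
    show "(SUP n. ennreal (v (idx n x) x)) \<le> \<phi> x"
      using v_le[OF x] by (rule SUP_least)
  qed
  \<comment> \<open>By monotone convergence the first \<open>n + 1\<close> minorants, for some
    finite \<open>n\<close>, already integrate to more than 1.\<close>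
  have "incseq (\<lambda>n \<omega>. ennreal (v (idx n \<bar>f \<omega>\<bar>) \<bar>f \<omega>\<bar>))"
    by (intro incseq_SucI le_funI ennreal_leI idx_max order_trans[OF idx_le]) simp
  then have "(\<integral>\<^sup>+\<omega>. \<phi> \<bar>f \<omega>\<bar> \<partial>P) = (SUP n. \<integral>\<^sup>+\<omega>. ennreal (v (idx n \<bar>f \<omega>\<bar>) \<bar>f \<omega>\<bar>) \<partial>P)"
    by (subst nn_integral_monotone_convergence_SUP[symmetric]) (auto simp: phi_eq v_def)
  then obtain n where n: "1 < (\<integral>\<^sup>+\<omega>. ennreal (v (idx n \<bar>f \<omega>\<bar>) \<bar>f \<omega>\<bar>) \<partial>P)"
    using gt by (auto simp: less_SUP_iff)
  define A where "A \<omega> = a (idx n \<bar>f \<omega>\<bar>)" for \<omega>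
  define B where "B \<omega> = b (idx n \<bar>f \<omega>\<bar>)" for \<omega>
  have [measurable]: "A \<in> borel_measurable P" "B \<in> borel_measurable P"
    unfolding A_def[abs_def] B_def[abs_def] by measurable
  have AB: "0 \<le> A \<omega>" "0 \<le> B \<omega>" for \<omega> using ab by (auto simp: A_def B_def)
  \<comment> \<open>Finite because \<open>B\<close> takes only the values \<open>b 0\<close>, ...,
    \<open>b n\<close>. The summand 1 is the bound of the modular on its unit ball and also keeps
    \<open>c\<close> nonzero.\<close>
  define c where "c = 1 + (\<integral>\<^sup>+\<omega>. ennreal (B \<omega>) \<partial>P)"
  have "(\<integral>\<^sup>+\<omega>. ennreal (B \<omega>) \<partial>P) \<le> (\<integral>\<^sup>+\<omega>. ennreal (\<Sum>i\<le>n. b i) \<partial>P)"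
    using ab idx_le unfolding B_def by (intro nn_integral_mono ennreal_leI member_le_sum) auto
  also have "\<dots> < \<infinity>" by (simp add: emeasure_space_1)
  finally have c: "c \<noteq> 0" "c \<noteq> \<infinity>" by (auto simp: c_def)
  \<comment> \<open>The equality used along \<open>f\<close>: where the minorant is nonnegative,
    \<open>ennreal\<close> truncates nothing.\<close>
  have split: "ennreal (A \<omega>) * ennreal z = ennreal (A \<omega> * z - B \<omega>) + ennreal (B \<omega>)"
    if "0 \<le> A \<omega> * z - B \<omega>" "0 \<le> z" for \<omega> z
    using that AB by (simp add: ennreal_mult[symmetric] ennreal_plus[symmetric] del: ennreal_plus)
  \<comment> \<open>Young's inequality at an arbitrary argument. The minorant chosen for
    \<open>|f|\<close> may be negative there, hence the maximum with 0.\<close>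
  have upper: "ennreal (A \<omega>) * ennreal z \<le> \<phi> z + ennreal (B \<omega>)" if z: "0 \<le> z" for \<omega> z
  proof -
    have "ennreal (A \<omega>) * ennreal z = ennreal (A \<omega> * z)"
      using AB z by (simp add: ennreal_mult)
    also have "\<dots> \<le> ennreal (max 0 (A \<omega> * z - B \<omega>) + B \<omega>)"
      by (intro ennreal_leI) auto
    also have "\<dots> = ennreal (A \<omega> * z - B \<omega>) + ennreal (B \<omega>)"
      using AB by (simp add: ennreal_plus max_def ennreal_neg)
    also have "\<dots> \<le> \<phi> z + ennreal (B \<omega>)"
      using v_le[OF z] by (intro add_right_mono) (simp add: A_def B_def v_def)
    finally show ?thesis .
  qed
  show thesis
  proof (rule that[of "\<lambda>\<omega>. ennreal (A \<omega>) / c"])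
    fix g assume [measurable]: "g \<in> borel_measurable P" and g: "(\<integral>\<^sup>+\<omega>. \<phi> \<bar>g \<omega>\<bar> \<partial>P) \<le> 1"
    have [measurable]: "(\<lambda>\<omega>. \<phi> \<bar>g \<omega>\<bar>) \<in> borel_measurable P"
      using borel_measurable_orlicz[OF \<phi>] by measurable
    have "(\<integral>\<^sup>+\<omega>. ennreal (A \<omega>) / c * ennreal \<bar>g \<omega>\<bar> \<partial>P)
        = (\<integral>\<^sup>+\<omega>. ennreal (A \<omega>) * ennreal \<bar>g \<omega>\<bar> \<partial>P) / c"
      by (simp add: nn_integral_cmult divide_ennreal_def mult_ac)
    also have "\<dots> \<le> (\<integral>\<^sup>+\<omega>. \<phi> \<bar>g \<omega>\<bar> + ennreal (B \<omega>) \<partial>P) / c"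
      by (intro divide_right_mono_ennreal nn_integral_mono upper) simp
    also have "\<dots> \<le> c / c"
      using g by (intro divide_right_mono_ennreal) (simp add: nn_integral_add c_def add_right_mono)
    also have "\<dots> = 1" using c by (simp add: ennreal_divide_self less_top)
    finally show "(\<integral>\<^sup>+\<omega>. ennreal (A \<omega>) / c * ennreal \<bar>g \<omega>\<bar> \<partial>P) \<le> 1" .
  next
    have "c \<le> (\<integral>\<^sup>+\<omega>. ennreal (A \<omega> * \<bar>f \<omega>\<bar> - B \<omega>) \<partial>P) + (\<integral>\<^sup>+\<omega>. ennreal (B \<omega>) \<partial>P)"
      using n unfolding c_def by (intro add_right_mono) (simp add: A_def B_def v_def)
    also have "\<dots> = (\<integral>\<^sup>+\<omega>. ennreal (A \<omega>) * ennreal \<bar>f \<omega>\<bar> \<partial>P)"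
    proof -
      have "0 \<le> A \<omega> * \<bar>f \<omega>\<bar> - B \<omega>" for \<omega>
        using v_nonneg[of n "\<bar>f \<omega>\<bar>"] by (simp add: A_def B_def v_def)
      then show ?thesis by (simp add: nn_integral_add[symmetric] split)
    qed
    finally have "c / c \<le> (\<integral>\<^sup>+\<omega>. ennreal (A \<omega>) * ennreal \<bar>f \<omega>\<bar> \<partial>P) / c"
      by (rule divide_right_mono_ennreal)
    also have "\<dots> = (\<integral>\<^sup>+\<omega>. ennreal (A \<omega>) / c * ennreal \<bar>f \<omega>\<bar> \<partial>P)"
      by (simp add: nn_integral_cmult divide_ennreal_def mult_ac)
    finally show "1 \<le> (\<integral>\<^sup>+\<omega>. ennreal (A \<omega>) / c * ennreal \<bar>f \<omega>\<bar> \<partial>P)"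
      using c by (simp add: ennreal_divide_self less_top)
  qed simp
qed

section \<open>Scaling of Orlicz functions; the identity and the supremum of a family\<close>

lemma orlicz_mono: "orlicz_function \<phi> \<Longrightarrow> 0 \<le> x \<Longrightarrow> x \<le> y \<Longrightarrow> \<phi> x \<le> \<phi> y"
  by (auto simp: orlicz_function_def intro: mono_onD)

text \<open>Convexity on the segment from \<open>0\<close>, where \<phi> vanishes.\<close>

lemma orlicz_scale:
  assumes "orlicz_function \<phi>" "0 \<le> x" "0 \<le> t" "t \<le> 1"
  shows "\<phi> (t * x) \<le> ennreal t * \<phi> x"
proof -
  have "\<phi> ((1 - t) * 0 + t * x) \<le> ennreal (1 - t) * \<phi> 0 + ennreal t * \<phi> x"
    using assms unfolding orlicz_function_def by fastforce
  then show ?thesis using assms by (simp add: orlicz_function_def)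
qed

text \<open>Scaling a point of finite value \<open>r\<close> by \<open>1 / (1 + r)\<close> brings
  the value down to at most \<open>r / (1 + r)\<close>.\<close>

lemma orlicz_le_1:
  assumes "orlicz_function \<phi>"
  obtains \<kappa> :: real where "0 < \<kappa>" "\<phi> \<kappa> \<le> 1"
proof -
  obtain x where x: "0 < x" "\<phi> x < \<infinity>" using assms by (auto simp: orlicz_function_def)
  then obtain r where r: "0 \<le> r" "\<phi> x = ennreal r" by (cases "\<phi> x") auto
  have "\<phi> (1 / (1 + r) * x) \<le> ennreal (1 / (1 + r)) * \<phi> x"
    using x r by (intro orlicz_scale[OF assms]) auto
  also have "\<dots> = ennreal (r / (1 + r))" using r by (simp add: ennreal_mult[symmetric])
  also have "\<dots> \<le> 1" using r by (simp add: ennreal_le_1)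
  finally show thesis using that[of "1 / (1 + r) * x"] x r by simp
qed

text \<open>On the half-line \<open>ennreal\<close> is the identity, whose modular is the L1 norm.
  It serves as every \<open>\<psi>_Q\<close> in the general representation.\<close>

lemma orlicz_function_ennreal: "orlicz_function ennreal"
  unfolding orlicz_function_def
proof (intro conjI allI impI ballI)
  fix x :: real assume "0 \<le> x"
  have "(ennreal \<longlongrightarrow> ennreal x) (at x within {0..})" by (intro tendsto_ennrealI) simp
  then show "ennreal x \<le> Liminf (at x within {0..}) ennreal"
    unfolding le_Liminf_iff using order_tendstoD(1) by blast
next
  show "mono_on {0..} ennreal" by (auto intro: mono_onI ennreal_leI)
  show "\<exists>x>0. ennreal x < \<infinity>" "\<exists>x>0. 0 < ennreal x" by (auto intro: exI[of _ 1])
qed (auto simp: ennreal_mult[symmetric] ennreal_plus[symmetric] simp del: ennreal_plus)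

text \<open>Lower semicontinuity, monotonicity and convexity pass to suprema, and one member
  provides positivity. Finiteness at a positive point can get lost in a supremum and is therefore
  assumed.\<close>

lemma orlicz_function_phi_Max:
  assumes "\<PP> \<noteq> {}" and \<Phi>: "\<And>P. P \<in> \<PP> \<Longrightarrow> orlicz_function (\<Phi> P)"
    and fin: "0 < x" "phi_Max \<PP> \<Phi> x < \<infinity>"
  shows "orlicz_function (phi_Max \<PP> \<Phi>)"
  unfolding orlicz_function_def
proof (intro conjI allI impI ballI)
  have upper: "\<Phi> P y \<le> phi_Max \<PP> \<Phi> y" if "P \<in> \<PP>" for P y
    using that by (auto simp: phi_Max_def intro: SUP_upper)
  {
    fix y :: real assume "0 \<le> y"
    then show "phi_Max \<PP> \<Phi> y \<le> Liminf (at y within {0..}) (phi_Max \<PP> \<Phi>)"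
      unfolding phi_Max_def[of _ _ y]
    proof (intro SUP_least)
      fix P assume P: "P \<in> \<PP>"
      have "\<Phi> P y \<le> Liminf (at y within {0..}) (\<Phi> P)"
        using \<Phi>[OF P] \<open>0 \<le> y\<close> by (simp add: orlicz_function_def)
      also have "\<dots> \<le> Liminf (at y within {0..}) (phi_Max \<PP> \<Phi>)"
        by (intro Liminf_mono always_eventually allI upper P)
      finally show "\<Phi> P y \<le> Liminf (at y within {0..}) (phi_Max \<PP> \<Phi>)" .
    qed
  next
    show "mono_on {0..} (phi_Max \<PP> \<Phi>)"
      unfolding phi_Max_def by (intro mono_onI SUP_mono) (meson \<Phi> atLeast_iff orlicz_mono)
  next
    fix y z t :: real assume *: "0 \<le> y" "0 \<le> z" "t \<in> {0..1}"
    show "phi_Max \<PP> \<Phi> ((1 - t) * y + t * z) \<le> ennreal (1 - t) * phi_Max \<PP> \<Phi> y + ennreal t * phi_Max \<PP> \<Phi> z"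
      unfolding phi_Max_def[of _ _ "_ + _"]
    proof (intro SUP_least)
      fix P assume P: "P \<in> \<PP>"
      have "\<Phi> P ((1 - t) * y + t * z) \<le> ennreal (1 - t) * \<Phi> P y + ennreal t * \<Phi> P z"
        using \<Phi>[OF P] * by (simp add: orlicz_function_def)
      also have "\<dots> \<le> ennreal (1 - t) * phi_Max \<PP> \<Phi> y + ennreal t * phi_Max \<PP> \<Phi> z"
        by (intro add_mono mult_left_mono upper P) auto
      finally show "\<Phi> P ((1 - t) * y + t * z) \<le> \<dots>" .
    qed
  next
    have "\<Phi> P 0 = 0" if "P \<in> \<PP>" for P using \<Phi>[OF that] by (simp add: orlicz_function_def)
    then show "phi_Max \<PP> \<Phi> 0 = 0" using \<open>\<PP> \<noteq> {}\<close> by (simp add: phi_Max_def cong: SUP_cong)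
  next
    show "\<exists>x>0. phi_Max \<PP> \<Phi> x < \<infinity>" using fin by auto
  next
    obtain P where P: "P \<in> \<PP>" using \<open>\<PP> \<noteq> {}\<close> by auto
    then obtain y where "0 < y" "0 < \<Phi> P y" using \<Phi>[OF P] by (auto simp: orlicz_function_def)
    then show "\<exists>x>0. 0 < phi_Max \<PP> \<Phi> x" using upper[OF P, of y] by (auto intro: less_le_trans)
  }
qed

subsection \<open>Mixtures and total variation\<close>

lemma sets_mixture [simp]: "sets (mixture M l P) = sets M"
  by (simp add: mixture_def)

lemma nn_integral_mixture:
  assumes P: "\<And>n. P n \<in> space (subprob_algebra M)" and f: "f \<in> borel_measurable M"
  shows "(\<integral>\<^sup>+\<omega>. f \<omega> \<partial>mixture M l P) = (\<Sum>n. ennreal (l n) * (\<integral>\<^sup>+\<omega>. f \<omega> \<partial>P n))"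
proof -
  let ?D = "density (count_space UNIV) (\<lambda>n. ennreal (l n))"
  have meas: "P \<in> ?D \<rightarrow>\<^sub>M subprob_algebra M" using P by auto
  have int: "(\<integral>\<^sup>+n. h n \<partial>?D) = (\<Sum>n. ennreal (l n) * h n)" for h :: "nat \<Rightarrow> ennreal"
    by (simp add: nn_integral_density nn_integral_count_space_nat)
  have sets: "sets (?D \<bind> P) = sets M"
    using P by (intro sets_bind) (auto dest: subprob_algebra_cong simp: space_subprob_algebra)
  have "mixture M l P = measure_of (space M) (sets M) (emeasure (?D \<bind> P))"
    unfolding mixture_def
  proof (rule measure_of_eq)
    fix A assume "A \<in> sigma_sets (space M) (sets M)"
    then have "A \<in> sets M" by (simp add: sets.sigma_sets_eq)
    then show "(\<Sum>n. ennreal (l n) * emeasure (P n) A) = emeasure (?D \<bind> P) A"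
      using meas by (subst emeasure_bind) (auto simp: int)
  qed (rule sets.space_closed)
  also have "\<dots> = ?D \<bind> P"
    using measure_of_of_measure[of "?D \<bind> P"] sets by (simp add: sets_eq_imp_space_eq[OF sets])
  finally show ?thesis
    using nn_integral_bind[OF f meas] by (simp add: int)
qed

text \<open>By additivity every finite partition sum of a nonnegative measure is the measure of the
  whole set, so the supremum is over a constant. Through this the conditions in \<open>ca\<close>
  and \<open>ca_L_Phi\<close> speak about \<open>Q\<close> itself.\<close>

lemma variation_measure:
  assumes "finite_measure Q" and sets: "sets Q = sets M"
  shows "variation M (measure Q) = Q"
proof -
  interpret finite_measure Q by fact
  have "variation M (measure Q) = measure_of (space Q) (sets Q) (emeasure Q)"
    unfolding variation_def sets_eq_imp_space_eq[OF sets] sets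
  proof (rule measure_of_eq)
    fix A assume "A \<in> sigma_sets (space M) (sets M)"
    then have A: "A \<in> sets M" by (simp add: sets.sigma_sets_eq)
    have "ennreal (\<Sum>B\<in>\<pi>. \<bar>measure Q B\<bar>) = emeasure Q A"
      if \<pi>: "finite \<pi>" "\<pi> \<subseteq> sets M" "partition_on A \<pi>" for \<pi>
    proof -
      have "measure Q (\<Union>B\<in>\<pi>. B) = (\<Sum>B\<in>\<pi>. measure Q B)"
        using \<pi> sets by (intro finite_measure_finite_Union)
          (auto simp: partition_on_def disjoint_family_on_def disjoint_def)
      then show ?thesis using \<pi> by (simp add: partition_on_def emeasure_eq_measure)
    qed
    \<comment> \<open>A partition exists, so the supremum of the constant is not an empty one.
      Blocks must be nonempty, hence the separate case of the empty set.\<close>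
    moreover have "(if A = {} then {} else {A}) \<in> {\<pi>. finite \<pi> \<and> \<pi> \<subseteq> sets M \<and> partition_on A \<pi>}"
      using A by (simp add: partition_on_def)
    then have "{\<pi>. finite \<pi> \<and> \<pi> \<subseteq> sets M \<and> partition_on A \<pi>} \<noteq> {}" by blast
    ultimately show "(SUP \<pi>\<in>{\<pi>. finite \<pi> \<and> \<pi> \<subseteq> sets M \<and> partition_on A \<pi>}.
        ennreal (\<Sum>B\<in>\<pi>. \<bar>measure Q B\<bar>)) = emeasure Q A"
      by (subst SUP_cong[OF refl, of _ _ "\<lambda>_. emeasure Q A"]) auto
  qed (rule sets.space_closed)
  then show ?thesis by (simp add: measure_of_of_measure)
qed

lemma signed_measure_measure:
  assumes "finite_measure Q" and sets: "sets Q = sets M"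
  shows "signed_measure M (measure Q)"
proof -
  interpret finite_measure Q by fact
  show ?thesis
    using sets by (auto simp: signed_measure_def measure_notin_sets intro!: finite_measure_UNION)
qed

subsection \<open>Norms and equivalence classes\<close>

lemma orlicz_norm_finite_iff:
  "orlicz_norm \<PP> \<Phi> f < \<infinity> \<longleftrightarrow> (\<exists>l>0. \<forall>P\<in>\<PP>. (\<integral>\<^sup>+\<omega>. \<Phi> P (inverse l * \<bar>f \<omega>\<bar>) \<partial>P) \<le> 1)"
  by (auto simp: orlicz_norm_def Inf_less_iff SUP_le_iff)

lemma orlicz_norm_less_ennrealE:
  assumes "orlicz_norm \<PP> \<Phi> f < ennreal \<delta>"
  obtains l where "0 < l" "l < \<delta>" "\<And>P. P \<in> \<PP> \<Longrightarrow> (\<integral>\<^sup>+\<omega>. \<Phi> P (inverse l * \<bar>f \<omega>\<bar>) \<partial>P) \<le> 1"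
  using assms by (auto simp: orlicz_norm_def Inf_less_iff SUP_le_iff ennreal_less_iff)

lemma L0_borel_measurable: "X \<in> L0 M \<PP> \<Longrightarrow> f \<in> X \<Longrightarrow> f \<in> borel_measurable M"
  by (auto simp: L0_def qs_rel_def quotient_def)

lemma AE_eq_iff_prob_eq_1:
  assumes P: "P \<in> space (prob_algebra M)" and fg: "f \<in> borel_measurable M" "g \<in> borel_measurable M"
  shows "\<P>(\<omega> in P. f \<omega> = g \<omega>) = 1 \<longleftrightarrow> (AE \<omega> in P. f \<omega> = (g \<omega> :: real))"
proof -
  interpret prob_space P using P by (simp add: space_prob_algebra)
  have sets: "sets P = sets M" using P by (simp add: space_prob_algebra)
  have [measurable]: "f \<in> borel_measurable P" "g \<in> borel_measurable P"
    using fg measurable_cong_sets[OF sets refl] by blast+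
  show ?thesis by (intro prob_Collect_eq_1) measurable
qed

lemma L0_AE_eq:
  assumes "\<PP> \<subseteq> space (prob_algebra M)" "X \<in> L0 M \<PP>" "f \<in> X" "h \<in> X" "P \<in> \<PP>"
  shows "AE \<omega> in P. f \<omega> = h \<omega>"
proof -
  obtain g where "(g, f) \<in> qs_rel M \<PP>" "(g, h) \<in> qs_rel M \<PP>"
    using assms by (auto simp: L0_def quotient_def)
  moreover have "P \<in> space (prob_algebra M)" using assms by auto
  ultimately have "AE \<omega> in P. g \<omega> = f \<omega>" "AE \<omega> in P. g \<omega> = h \<omega>"
    using \<open>P \<in> \<PP>\<close> by (auto simp: qs_rel_def AE_eq_iff_prob_eq_1)
  then show ?thesis by eventually_elim simp
qed

text \<open>Quasi-sure equality of \<open>f\<close> and \<open>g\<close> says that the set where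
  they differ is null for the whole family, so the relation depends on the family only through its
  null sets.\<close>

lemma L0_cong:
  assumes "equiv_measures M \<RR> \<PP>" "\<RR> \<subseteq> space (prob_algebra M)" "\<PP> \<subseteq> space (prob_algebra M)"
  shows "L0 M \<RR> = L0 M \<PP>"
proof -
  have "(\<forall>P\<in>\<SS>. \<P>(\<omega> in P. f \<omega> = g \<omega>) = 1) \<longleftrightarrow> (SUP P\<in>\<SS>. emeasure P {\<omega> \<in> space M. f \<omega> \<noteq> g \<omega>}) = 0"
    if \<SS>: "\<SS> \<subseteq> space (prob_algebra M)" and fg: "f \<in> borel_measurable M" "g \<in> borel_measurable M"
    for \<SS> and f g :: "'a \<Rightarrow> real"
  proof -
    have "\<P>(\<omega> in P. f \<omega> = g \<omega>) = 1 \<longleftrightarrow> emeasure P {\<omega> \<in> space M. f \<omega> \<noteq> g \<omega>} = 0" if "P \<in> \<SS>" for P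
    proof -
      have P: "P \<in> space (prob_algebra M)" and sets: "sets P = sets M"
        using that \<SS> by (auto simp: space_prob_algebra)
      have "{\<omega> \<in> space M. f \<omega> \<noteq> g \<omega>} \<in> sets M" using fg by measurable
      then show ?thesis
        unfolding AE_eq_iff_prob_eq_1[OF P fg]
        by (intro AE_iff_measurable) (auto simp: sets sets_eq_imp_space_eq[OF sets])
    qed
    then show ?thesis by (simp add: bot_ennreal[symmetric] SUP_bot_conv del: bot_ennreal)
  qed
  note null_iff = this
  have "(\<forall>P\<in>\<RR>. \<P>(\<omega> in P. f \<omega> = g \<omega>) = 1) \<longleftrightarrow> (\<forall>P\<in>\<PP>. \<P>(\<omega> in P. f \<omega> = g \<omega>) = 1)"
    if fg: "f \<in> borel_measurable M" "g \<in> borel_measurable M" for f g :: "'a \<Rightarrow> real"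
  proof -
    have "{\<omega> \<in> space M. f \<omega> \<noteq> g \<omega>} \<in> sets M" using fg by measurable
    then show ?thesis
      using assms(1) unfolding null_iff[OF assms(2) fg] null_iff[OF assms(3) fg] equiv_measures_def
      by blast
  qed
  then have "qs_rel M \<RR> = qs_rel M \<PP>"
    unfolding qs_rel_def by blast
  then show ?thesis by (simp add: L0_def)
qed

section \<open>Measures in \<open>ca_plus_1\<close> and the modular unit ball\<close>

locale orlicz_family =
  fixes M :: "'a measure" and \<PP> :: "'a measure set" and \<Phi> :: "'a measure \<Rightarrow> real \<Rightarrow> ennreal"
  assumes nonempty: "\<PP> \<noteq> {}"
    and prob_algebra: "\<PP> \<subseteq> space (prob_algebra M)"
    and orlicz: "\<And>P. P \<in> \<PP> \<Longrightarrow> orlicz_function (\<Phi> P)"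
begin

lemma sets_eq: "P \<in> \<PP> \<Longrightarrow> sets P = sets M" and prob: "P \<in> \<PP> \<Longrightarrow> prob_space P"
  using prob_algebra by (auto simp: space_prob_algebra)

lemma zero: "P \<in> \<PP> \<Longrightarrow> \<Phi> P 0 = 0"
  using orlicz by (simp add: orlicz_function_def)

text \<open>A bound on the modular unit ball is all that membership takes: by homogeneity it yields
  integrability and Lipschitz continuity, and applied to large multiples of indicators it shows that
  \<open>Q\<close> charges no set that is null for all of \<open>\<PP>\<close>.\<close>

lemma ca_plus_1I:
  assumes Q: "Q \<in> space (prob_algebra M)" and C: "0 \<le> C"
    and bound: "\<And>g. g \<in> borel_measurable M \<Longrightarrow> (\<And>P. P \<in> \<PP> \<Longrightarrow> (\<integral>\<^sup>+\<omega>. \<Phi> P \<bar>g \<omega>\<bar> \<partial>P) \<le> 1) \<Longrightarrow>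
      (\<integral>\<^sup>+\<omega>. ennreal \<bar>g \<omega>\<bar> \<partial>Q) \<le> ennreal C"
  shows "Q \<in> ca_plus_1 M \<PP> \<Phi>"
proof -
  have sets: "sets Q = sets M" using Q by (simp add: space_prob_algebra)
  interpret Q: prob_space Q using Q by (simp add: space_prob_algebra)
  have Q_meas: "f \<in> borel_measurable Q" if "f \<in> borel_measurable M" for f :: "'a \<Rightarrow> real"
    using that measurable_cong_sets[OF sets refl] by blast
  have var: "variation M (measure Q) = Q"
    using Q.finite_measure_axioms sets by (rule variation_measure)
  have class_meas: "f \<in> borel_measurable M" if "X \<in> L_Phi M \<PP> \<Phi>" "f \<in> X" for X f
    using that by (auto simp: L_Phi_def L0_def qs_rel_def quotient_def)
  have class_norm: "orlicz_norm \<PP> \<Phi> f < \<infinity>" if "X \<in> L_Phi M \<PP> \<Phi>" "f \<in> X" for X f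
    using that by (auto simp: L_Phi_def)
  \<comment> \<open>Homogeneity extends the bound from the modular unit ball to its
    multiples.\<close>
  have scaled: "(\<integral>\<^sup>+\<omega>. ennreal \<bar>f \<omega>\<bar> \<partial>Q) \<le> ennreal (C * l)"
    if [measurable]: "f \<in> borel_measurable M" and l: "0 < l"
      and le: "\<And>P. P \<in> \<PP> \<Longrightarrow> (\<integral>\<^sup>+\<omega>. \<Phi> P (inverse l * \<bar>f \<omega>\<bar>) \<partial>P) \<le> 1" for f l
  proof -
    note [measurable] = Q_meas[OF that(1)]
    have abs: "\<bar>inverse l * f \<omega>\<bar> = inverse l * \<bar>f \<omega>\<bar>" for \<omega> using l by (simp add: abs_mult)
    have "(\<integral>\<^sup>+\<omega>. ennreal \<bar>f \<omega>\<bar> \<partial>Q) = (\<integral>\<^sup>+\<omega>. ennreal l * ennreal \<bar>inverse l * f \<omega>\<bar> \<partial>Q)"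
      using l by (simp add: abs ennreal_mult[symmetric] mult.assoc[symmetric])
    also have "\<dots> = ennreal l * (\<integral>\<^sup>+\<omega>. ennreal \<bar>inverse l * f \<omega>\<bar> \<partial>Q)"
      by (rule nn_integral_cmult) simp
    also have "\<dots> \<le> ennreal l * ennreal C"
      by (intro mult_left_mono bound) (use le in \<open>auto simp: abs\<close>)
    finally show ?thesis using C l by (simp add: ennreal_mult mult.commute)
  qed
  have integrable: "integrable Q f" if X: "X \<in> L_Phi M \<PP> \<Phi>" "f \<in> X" for X f
  proof -
    obtain l where "0 < l" "\<And>P. P \<in> \<PP> \<Longrightarrow> (\<integral>\<^sup>+\<omega>. \<Phi> P (inverse l * \<bar>f \<omega>\<bar>) \<partial>P) \<le> 1"
      using class_norm[OF X] unfolding orlicz_norm_finite_iff by blast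
    from scaled[OF class_meas[OF X] this] have "(\<integral>\<^sup>+\<omega>. ennreal \<bar>f \<omega>\<bar> \<partial>Q) \<le> ennreal (C * l)" .
    also have "\<dots> < \<infinity>" by (simp add: less_top[symmetric])
    finally have "(\<integral>\<^sup>+\<omega>. ennreal \<bar>f \<omega>\<bar> \<partial>Q) < \<infinity>" .
    then show ?thesis using Q_meas[OF class_meas[OF X]] by (simp add: integrable_iff_bounded)
  qed
  have null: "emeasure Q N = 0" if N: "N \<in> sets M" "(SUP P\<in>\<PP>. emeasure P N) = 0" for N
  proof -
    have PN: "emeasure P N = 0" if "P \<in> \<PP>" for P
      using SUP_upper[OF that, of "\<lambda>P. emeasure P N"] N(2) by simp
    \<comment> \<open>Every multiple of the indicator of \<open>N\<close> vanishes almost surely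
      under each \<open>P\<close> and so lies in the modular unit ball. Hence \<open>n Q(N)\<close>
      is bounded in \<open>n\<close>, which forces \<open>Q(N) = 0\<close>.\<close>
    have le: "of_nat n * emeasure Q N \<le> ennreal C" for n
    proof -
      have "(\<integral>\<^sup>+\<omega>. ennreal \<bar>real n * indicator N \<omega>\<bar> \<partial>Q) \<le> ennreal C"
      proof (rule bound)
        fix P assume P: "P \<in> \<PP>"
        have "AE \<omega> in P. \<omega> \<notin> N"
          using PN[OF P] N(1) sets_eq[OF P] by (intro AE_not_in) (auto simp: null_sets_def)
        then have "AE \<omega> in P. \<Phi> P \<bar>real n * indicator N \<omega>\<bar> = 0"
          by eventually_elim (simp add: zero P)
        then show "(\<integral>\<^sup>+\<omega>. \<Phi> P \<bar>real n * indicator N \<omega>\<bar> \<partial>P) \<le> 1"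
          by (simp cong: nn_integral_cong_AE)
      qed (use N in simp)
      moreover have "ennreal \<bar>real n * indicator N \<omega>\<bar> = of_nat n * indicator N \<omega>" for \<omega>
        by (simp add: indicator_def ennreal_of_nat_eq_real_of_nat)
      ultimately show ?thesis using N sets by (simp add: nn_integral_cmult_indicator)
    qed
    have "real n * measure Q N \<le> C" for n
      using le[of n] C by (simp add: Q.emeasure_eq_measure ennreal_of_nat_eq_real_of_nat ennreal_mult[symmetric])
    then have "measure Q N \<le> 0"
      using reals_Archimedean3[of "measure Q N"] by (meson linorder_not_less)
    then show ?thesis by (simp add: Q.emeasure_eq_measure ennreal_neg)
  qed
  have "\<exists>\<delta>>0. \<forall>Y\<in>L_Phi M \<PP> \<Phi>. \<forall>g\<in>Y. orlicz_norm \<PP> \<Phi> (\<lambda>\<omega>. g \<omega> - f \<omega>) < ennreal \<delta> \<longrightarrow>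
      \<bar>(\<integral>\<omega>. g \<omega> \<partial>Q) - (\<integral>\<omega>. f \<omega> \<partial>Q)\<bar> < \<epsilon>"
    if X: "X \<in> L_Phi M \<PP> \<Phi>" "f \<in> X" and \<epsilon>: "0 < \<epsilon>" for X f and \<epsilon> :: real
  proof (intro exI[of _ "\<epsilon> / (C + 1)"] conjI ballI impI)
    \<comment> \<open>The added 1 in the denominator covers the case \<open>C = 0\<close>.\<close>
    show "0 < \<epsilon> / (C + 1)" using C \<epsilon> by simp
    fix Y g assume Y: "Y \<in> L_Phi M \<PP> \<Phi>" "g \<in> Y"
      and "orlicz_norm \<PP> \<Phi> (\<lambda>\<omega>. g \<omega> - f \<omega>) < ennreal (\<epsilon> / (C + 1))"
    then obtain l where l: "0 < l" "l < \<epsilon> / (C + 1)"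
      "\<And>P. P \<in> \<PP> \<Longrightarrow> (\<integral>\<^sup>+\<omega>. \<Phi> P (inverse l * \<bar>g \<omega> - f \<omega>\<bar>) \<partial>P) \<le> 1"
      using orlicz_norm_less_ennrealE by blast
    note int = integrable[OF X] integrable[OF Y]
    have "ennreal (\<integral>\<omega>. \<bar>g \<omega> - f \<omega>\<bar> \<partial>Q) = (\<integral>\<^sup>+\<omega>. ennreal \<bar>g \<omega> - f \<omega>\<bar> \<partial>Q)"
      using int by (intro nn_integral_eq_integral[symmetric]) auto
    also have "\<dots> \<le> ennreal (C * l)"
      using class_meas[OF X] class_meas[OF Y] l by (intro scaled) auto
    finally have "(\<integral>\<omega>. \<bar>g \<omega> - f \<omega>\<bar> \<partial>Q) \<le> C * l"
      using C l by simp
    also have "C * l \<le> (C + 1) * l" using l by (simp add: algebra_simps)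
    also have "\<dots> < \<epsilon>" using l C by (simp add: field_simps)
    finally have "(\<integral>\<omega>. \<bar>g \<omega> - f \<omega>\<bar> \<partial>Q) < \<epsilon>" .
    moreover have "(\<integral>\<omega>. g \<omega> \<partial>Q) - (\<integral>\<omega>. f \<omega> \<partial>Q) = (\<integral>\<omega>. g \<omega> - f \<omega> \<partial>Q)"
      using int by simp
    ultimately show "\<bar>(\<integral>\<omega>. g \<omega> \<partial>Q) - (\<integral>\<omega>. f \<omega> \<partial>Q)\<bar> < \<epsilon>"
      using integral_abs_bound[of Q "\<lambda>\<omega>. g \<omega> - f \<omega>"] by linarith
  qed
  moreover have "measure Q \<in> ca M \<PP>"
    unfolding ca_def mem_Collect_eq var
    using null Q.emeasure_finite signed_measure_measure[OF Q.finite_measure_axioms sets]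
    by (auto simp: less_top[symmetric])
  ultimately have "measure Q \<in> ca_L_Phi M \<PP> \<Phi>"
    unfolding ca_L_Phi_def mem_Collect_eq var using integrable by blast
  then show ?thesis using Q by (simp add: ca_plus_1_def)
qed

text \<open>Since \<open>\<Phi> P\<close> is positive somewhere, it has an affine minorant
  \<open>a z - b\<close> with positive slope. Then \<open>a |g|\<close> is at most
  \<open>\<Phi> P |g| + b\<close>, and integrating over the modular unit ball gives the constant
  \<open>(1 + b) / a\<close>.\<close>

lemma in_ca_plus_1:
  assumes P: "P \<in> \<PP>"
  shows "P \<in> ca_plus_1 M \<PP> \<Phi>"
proof -
  interpret prob_space P using P by (rule prob)
  obtain x where x: "0 < x" "0 < \<Phi> P x" using orlicz[OF P] by (auto simp: orlicz_function_def)
  obtain a b where ab: "0 \<le> a" "0 \<le> b" "0 < ennreal (a * x - b)"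
    "\<And>z. 0 \<le> z \<Longrightarrow> ennreal (a * z - b) \<le> \<Phi> P z"
    using orlicz_affine_minorant[OF orlicz[OF P] _ x(2)] x(1) by (metis less_imp_le)
  \<comment> \<open>With slope 0 the minorant could not be positive at \<open>x\<close>, as
    \<open>b\<close> is nonnegative.\<close>
  then have a: "0 < a" using x by (cases "a = 0") (auto simp: ennreal_neg)
  show ?thesis
  proof (rule ca_plus_1I)
    show "0 \<le> (1 + b) / a" using ab a by simp
    show "P \<in> space (prob_algebra M)" using P prob_algebra by auto
    fix g assume g: "g \<in> borel_measurable M" and "\<And>P. P \<in> \<PP> \<Longrightarrow> (\<integral>\<^sup>+\<omega>. \<Phi> P \<bar>g \<omega>\<bar> \<partial>P) \<le> 1"
    then have le: "(\<integral>\<^sup>+\<omega>. \<Phi> P \<bar>g \<omega>\<bar> \<partial>P) \<le> 1" using P by auto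
    have [measurable]: "g \<in> borel_measurable P"
      using g measurable_cong_sets[OF sets_eq[OF P] refl] by blast
    have "ennreal \<bar>g \<omega>\<bar> \<le> ennreal (1 / a) * \<Phi> P \<bar>g \<omega>\<bar> + ennreal (b / a)" for \<omega>
    proof -
      have "ennreal \<bar>g \<omega>\<bar> \<le> ennreal (1 / a * max 0 (a * \<bar>g \<omega>\<bar> - b) + b / a)"
        using a by (intro ennreal_leI) (auto simp: field_simps)
      also have "\<dots> = ennreal (1 / a) * ennreal (a * \<bar>g \<omega>\<bar> - b) + ennreal (b / a)"
      proof -
        have "ennreal (max 0 (a * \<bar>g \<omega>\<bar> - b)) = ennreal (a * \<bar>g \<omega>\<bar> - b)"
          by (simp add: max_def ennreal_neg)
        then show ?thesis
          using a ab by (simp add: ennreal_plus ennreal_mult del: times_divide_eq_left)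
      qed
      also have "\<dots> \<le> ennreal (1 / a) * \<Phi> P \<bar>g \<omega>\<bar> + ennreal (b / a)"
        by (intro add_right_mono mult_left_mono ab) auto
      finally show ?thesis .
    qed
    then have "(\<integral>\<^sup>+\<omega>. ennreal \<bar>g \<omega>\<bar> \<partial>P) \<le> (\<integral>\<^sup>+\<omega>. ennreal (1 / a) * \<Phi> P \<bar>g \<omega>\<bar> + ennreal (b / a) \<partial>P)"
      by (intro nn_integral_mono)
    also have "\<dots> = ennreal (1 / a) * (\<integral>\<^sup>+\<omega>. \<Phi> P \<bar>g \<omega>\<bar> \<partial>P) + ennreal (b / a)"
    proof -
      have [measurable]: "(\<lambda>\<omega>. \<Phi> P \<bar>g \<omega>\<bar>) \<in> borel_measurable P"
        using borel_measurable_orlicz[OF orlicz[OF P]] by measurable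
      show ?thesis by (simp add: nn_integral_add nn_integral_cmult emeasure_space_1)
    qed
    also have "\<dots> \<le> ennreal (1 / a) * 1 + ennreal (b / a)"
      by (intro add_right_mono mult_left_mono le) simp
    also have "\<dots> = ennreal ((1 + b) / a)"
      using a ab by (simp add: ennreal_plus[symmetric] add_divide_distrib del: ennreal_plus)
    finally show "(\<integral>\<^sup>+\<omega>. ennreal \<bar>g \<omega>\<bar> \<partial>P) \<le> ennreal ((1 + b) / a)" .
  qed
qed

text \<open>The constant 1 tests the inclusion: finiteness of its norm is a uniform bound on the
  \<open>\<Phi> P\<close> at one point. Conversely, every bounded function can be scaled below such
  a point \<kappa>.\<close>

lemma Linf_subset_L_Phi_iff:
  "Linf M \<PP> \<subseteq> L_Phi M \<PP> \<Phi> \<longleftrightarrow> (\<exists>\<kappa>>0. \<forall>P\<in>\<PP>. \<Phi> P \<kappa> \<le> 1)"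
proof
  assume sub: "Linf M \<PP> \<subseteq> L_Phi M \<PP> \<Phi>"
  let ?one = "\<lambda>\<omega>. 1 :: real"
  let ?X = "qs_rel M \<PP> `` {?one}"
  have mem: "?one \<in> ?X"
    using prob by (auto simp: qs_rel_def prob_space.prob_space)
  have "?X \<in> L0 M \<PP>" by (auto simp: L0_def intro: quotientI)
  then have "?X \<in> Linf M \<PP>" using mem by (auto simp: Linf_def)
  then have "orlicz_norm \<PP> \<Phi> ?one < \<infinity>" using sub mem by (auto simp: L_Phi_def)
  then obtain l where l: "0 < l" "\<And>P. P \<in> \<PP> \<Longrightarrow> (\<integral>\<^sup>+\<omega>. \<Phi> P (inverse l * \<bar>1\<bar>) \<partial>P) \<le> 1"
    unfolding orlicz_norm_finite_iff by blast
  have "\<Phi> P (inverse l) \<le> 1" if "P \<in> \<PP>" for P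
    using l(2)[OF that] prob_space.emeasure_space_1[OF prob[OF that]] by simp
  then show "\<exists>\<kappa>>0. \<forall>P\<in>\<PP>. \<Phi> P \<kappa> \<le> 1" using l(1) by (intro exI[of _ "inverse l"]) simp
next
  assume "\<exists>\<kappa>>0. \<forall>P\<in>\<PP>. \<Phi> P \<kappa> \<le> 1"
  then obtain \<kappa> where \<kappa>: "0 < \<kappa>" "\<And>P. P \<in> \<PP> \<Longrightarrow> \<Phi> P \<kappa> \<le> 1" by blast
  show "Linf M \<PP> \<subseteq> L_Phi M \<PP> \<Phi>"
  proof
    fix X assume X: "X \<in> Linf M \<PP>"
    then obtain f c where f: "f \<in> X" "\<And>\<omega>. \<omega> \<in> space M \<Longrightarrow> \<bar>f \<omega>\<bar> \<le> c" and L0: "X \<in> L0 M \<PP>"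
      by (auto simp: Linf_def)
    have "orlicz_norm \<PP> \<Phi> h < \<infinity>" if h: "h \<in> X" for h
      unfolding orlicz_norm_finite_iff
    proof (intro exI[of _ "max c 1 / \<kappa>"] conjI ballI)
      \<comment> \<open>Dividing by this scale brings \<open>|h|\<close> below \<kappa>; the maximum
        with 1 makes it positive for any \<open>c\<close>. The representative \<open>h\<close> obeys
        the bound only almost surely under each \<open>P\<close>.\<close>
      show "0 < max c 1 / \<kappa>" using \<kappa> by simp
      fix P assume P: "P \<in> \<PP>"
      interpret prob_space P using P by (rule prob)
      have "AE \<omega> in P. \<Phi> P (inverse (max c 1 / \<kappa>) * \<bar>h \<omega>\<bar>) \<le> 1"
        using L0_AE_eq[OF prob_algebra L0 f(1) h P] AE_space
      proof eventually_elim
        case (elim \<omega>)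
        then have "\<bar>h \<omega>\<bar> \<le> max c 1"
          using f(2)[of \<omega>] sets_eq_imp_space_eq[OF sets_eq[OF P]] by auto
        then have "inverse (max c 1 / \<kappa>) * \<bar>h \<omega>\<bar> \<le> \<kappa>"
          using \<kappa>(1) by (simp add: field_simps)
        then have "\<Phi> P (inverse (max c 1 / \<kappa>) * \<bar>h \<omega>\<bar>) \<le> \<Phi> P \<kappa>"
          using \<kappa>(1) by (intro orlicz_mono[OF orlicz[OF P]]) auto
        then show ?case using \<kappa>(2)[OF P] by (rule order_trans)
      qed
      then have "(\<integral>\<^sup>+\<omega>. \<Phi> P (inverse (max c 1 / \<kappa>) * \<bar>h \<omega>\<bar>) \<partial>P) \<le> (\<integral>\<^sup>+\<omega>. 1 \<partial>P)"
        by (rule nn_integral_mono_AE)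
      then show "(\<integral>\<^sup>+\<omega>. \<Phi> P (inverse (max c 1 / \<kappa>) * \<bar>h \<omega>\<bar>) \<partial>P) \<le> 1"
        by (simp add: emeasure_space_1)
    qed
    then show "X \<in> L_Phi M \<PP> \<Phi>" using L0 by (simp add: L_Phi_def)
  qed
qed

text \<open>A gliding hump: the pairing with each \<open>u k\<close> is at most 1 on the modular
  unit ball, while on \<open>f\<close> it is at least \<open>4 ^ k\<close>, which outgrows the decay
  of the weights \<open>(1/2) ^ Suc k\<close>. The uniform \<kappa> keeps the mixture
  finite.\<close>

lemma exists_ca_plus_1_infinite_integral:
  assumes \<kappa>: "0 < \<kappa>" "\<And>P. P \<in> \<PP> \<Longrightarrow> \<Phi> P \<kappa> \<le> 1"
    and f: "f \<in> borel_measurable M" and infinite: "\<not> orlicz_norm \<PP> \<Phi> f < \<infinity>"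
  shows "\<exists>Q\<in>ca_plus_1 M \<PP> \<Phi>. (\<integral>\<^sup>+\<omega>. ennreal \<bar>f \<omega>\<bar> \<partial>Q) = \<infinity>"
proof -
  have meas: "g \<in> borel_measurable P \<longleftrightarrow> g \<in> borel_measurable M" if "P \<in> \<PP>"
    for P and g :: "'a \<Rightarrow> 'b :: topological_space"
    using measurable_cong_sets[OF sets_eq[OF that] refl] by blast
  define good where "good k P u \<longleftrightarrow> P \<in> \<PP> \<and> u \<in> borel_measurable M \<and>
      (\<forall>g\<in>borel_measurable M. (\<integral>\<^sup>+\<omega>. \<Phi> P \<bar>g \<omega>\<bar> \<partial>P) \<le> 1 \<longrightarrow> (\<integral>\<^sup>+\<omega>. u \<omega> * ennreal \<bar>g \<omega>\<bar> \<partial>P) \<le> 1) \<and>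
      4 ^ k \<le> (\<integral>\<^sup>+\<omega>. u \<omega> * ennreal \<bar>f \<omega>\<bar> \<partial>P)" for k :: nat and P and u :: "'a \<Rightarrow> ennreal"
  have "\<exists>P u. good k P u" for k
  proof -
    \<comment> \<open>Infinite norm means that for some \<open>P\<close> the modular of
      \<open>f\<close> at scale \<open>4 ^ k\<close> exceeds 1. A dual density for \<open>h\<close>
      then pairs with \<open>f\<close> to at least \<open>4 ^ k\<close>.\<close>
    define h where "h \<omega> = inverse (4 ^ k) * f \<omega>" for \<omega>
    have h: "h \<in> borel_measurable M" using f by (simp add: h_def[abs_def])
    obtain P where P: "P \<in> \<PP>" "1 < (\<integral>\<^sup>+\<omega>. \<Phi> P (inverse (4 ^ k) * \<bar>f \<omega>\<bar>) \<partial>P)"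
      using infinite unfolding orlicz_norm_finite_iff by (auto simp: not_le dest!: spec[of _ "4 ^ k"])
    then have "1 < (\<integral>\<^sup>+\<omega>. \<Phi> P \<bar>h \<omega>\<bar> \<partial>P)" by (simp add: h_def abs_mult)
    then obtain u :: "'a \<Rightarrow> ennreal" where u: "u \<in> borel_measurable P"
      "\<And>g. \<lbrakk>g \<in> borel_measurable P; (\<integral>\<^sup>+\<omega>. \<Phi> P \<bar>g \<omega>\<bar> \<partial>P) \<le> 1\<rbrakk> \<Longrightarrow> (\<integral>\<^sup>+\<omega>. u \<omega> * ennreal \<bar>g \<omega>\<bar> \<partial>P) \<le> 1"
      "1 \<le> (\<integral>\<^sup>+\<omega>. u \<omega> * ennreal \<bar>h \<omega>\<bar> \<partial>P)"
      using orlicz_dual_density[OF prob[OF P(1)] orlicz[OF P(1)], of h] h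
      unfolding meas[OF P(1)] by blast
    note [measurable] = u(1) f[folded meas[OF P(1)]]
    have "4 ^ k * ennreal \<bar>h \<omega>\<bar> = ennreal \<bar>f \<omega>\<bar>" for \<omega>
    proof -
      have "4 ^ k * ennreal \<bar>h \<omega>\<bar> = ennreal (4 ^ k * \<bar>h \<omega>\<bar>)"
        by (simp add: ennreal_mult ennreal_power[symmetric])
      then show ?thesis by (simp add: h_def abs_mult)
    qed
    then have eq: "u \<omega> * ennreal \<bar>f \<omega>\<bar> = 4 ^ k * (u \<omega> * ennreal \<bar>h \<omega>\<bar>)" for \<omega>
      by (metis mult.left_commute)
    have "4 ^ k * 1 \<le> 4 ^ k * (\<integral>\<^sup>+\<omega>. u \<omega> * ennreal \<bar>h \<omega>\<bar> \<partial>P)"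
      using u(3) by (rule mult_left_mono) simp
    also have "\<dots> = (\<integral>\<^sup>+\<omega>. u \<omega> * ennreal \<bar>f \<omega>\<bar> \<partial>P)"
      unfolding eq using h[folded meas[OF P(1)]] by (intro nn_integral_cmult[symmetric]) measurable
    finally have "good k P u"
      unfolding good_def using P(1) u(1,2) unfolding meas[OF P(1)] by simp
    then show ?thesis by blast
  qed
  then obtain P u where good: "good k (P k) (u k)" for k by metis
  have P: "P k \<in> \<PP>" and u: "u k \<in> borel_measurable M"
    and large: "4 ^ k \<le> (\<integral>\<^sup>+\<omega>. u k \<omega> * ennreal \<bar>f \<omega>\<bar> \<partial>P k)" for k
    using good[of k] by (simp_all add: good_def)
  have dual: "(\<integral>\<^sup>+\<omega>. u k \<omega> * ennreal \<bar>g \<omega>\<bar> \<partial>P k) \<le> 1"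
    if "g \<in> borel_measurable M" "(\<integral>\<^sup>+\<omega>. \<Phi> (P k) \<bar>g \<omega>\<bar> \<partial>P k) \<le> 1" for g k
    using good[of k] that by (simp add: good_def)
  \<comment> \<open>The factor \<kappa> makes \<open>\<nu> k\<close> a sub-probability, because the
    constant \<kappa> lies in the modular unit ball and so pairs with \<open>u k\<close> to at most
    1.\<close>
  define \<nu> where "\<nu> k = density (P k) (\<lambda>\<omega>. ennreal \<kappa> * u k \<omega>)" for k
  have \<nu>_int: "(\<integral>\<^sup>+\<omega>. h \<omega> \<partial>\<nu> k) = ennreal \<kappa> * (\<integral>\<^sup>+\<omega>. u k \<omega> * h \<omega> \<partial>P k)"
    if "h \<in> borel_measurable M" for h k
  proof -
    have [measurable]: "h \<in> borel_measurable (P k)" "u k \<in> borel_measurable (P k)"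
      using that u by (simp_all add: meas[OF P])
    show ?thesis by (simp add: \<nu>_def nn_integral_density mult.assoc nn_integral_cmult)
  qed
  have \<nu>_sets: "sets (\<nu> k) = sets M" for k by (simp add: \<nu>_def sets_eq P)
  have \<nu>_sub: "\<nu> k \<in> space (subprob_algebra M)" for k
  proof -
    have "emeasure (\<nu> k) (space (\<nu> k)) = (\<integral>\<^sup>+\<omega>. 1 \<partial>\<nu> k)" by simp
    also have "\<dots> = ennreal \<kappa> * (\<integral>\<^sup>+\<omega>. u k \<omega> * 1 \<partial>P k)" by (rule \<nu>_int) simp
    also have "\<dots> = (\<integral>\<^sup>+\<omega>. u k \<omega> * ennreal \<bar>\<kappa>\<bar> \<partial>P k)"
    proof -
      have [measurable]: "u k \<in> borel_measurable (P k)" using u by (simp add: meas[OF P])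
      show ?thesis using \<kappa> by (simp add: nn_integral_cmult[symmetric] mult.commute)
    qed
    also have "\<dots> \<le> 1"
      using \<kappa> prob_space.emeasure_space_1[OF prob[OF P]] P by (intro dual) auto
    finally have "emeasure (\<nu> k) (space (\<nu> k)) \<le> 1" .
    moreover have "space (\<nu> k) \<noteq> {}"
      using prob_space.not_empty[OF prob[OF P]] by (simp add: \<nu>_def)
    ultimately show ?thesis
      by (simp add: space_subprob_algebra \<nu>_sets subprob_spaceI)
  qed
  define \<mu> where "\<mu> = mixture M (\<lambda>k. (1/2) ^ Suc k) \<nu>"
  have weights: "(\<Sum>k. ennreal ((1/2) ^ Suc k)) = ennreal 1"
    by (rule suminf_ennreal_eq[OF _ power_half_series]) simp
  have \<mu>_int: "(\<integral>\<^sup>+\<omega>. h \<omega> \<partial>\<mu>) = (\<Sum>k. ennreal ((1/2) ^ Suc k) * (ennreal \<kappa> * (\<integral>\<^sup>+\<omega>. u k \<omega> * h \<omega> \<partial>P k)))"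
    if "h \<in> borel_measurable M" for h
    unfolding \<mu>_def by (simp add: nn_integral_mixture[OF \<nu>_sub that] \<nu>_int[OF that])
  have \<mu>_sets: "sets \<mu> = sets M" by (simp add: \<mu>_def)
  have \<mu>_meas: "h \<in> borel_measurable \<mu> \<longleftrightarrow> h \<in> borel_measurable M" for h :: "'a \<Rightarrow> ennreal"
    using measurable_cong_sets[OF \<mu>_sets refl] by blast
  have abs_meas: "(\<lambda>\<omega>. ennreal \<bar>g \<omega>\<bar>) \<in> borel_measurable M" if "g \<in> borel_measurable M" for g
    using that by measurable
  \<comment> \<open>The weights sum to 1, so the bound \<kappa> of the components carries over to
    \<mu>.\<close>
  have ball: "(\<integral>\<^sup>+\<omega>. ennreal \<bar>g \<omega>\<bar> \<partial>\<mu>) \<le> ennreal \<kappa>"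
    if g: "g \<in> borel_measurable M" and le: "\<And>P. P \<in> \<PP> \<Longrightarrow> (\<integral>\<^sup>+\<omega>. \<Phi> P \<bar>g \<omega>\<bar> \<partial>P) \<le> 1" for g
  proof -
    have "(\<integral>\<^sup>+\<omega>. ennreal \<bar>g \<omega>\<bar> \<partial>\<mu>) \<le> (\<Sum>k. ennreal ((1/2) ^ Suc k) * (ennreal \<kappa> * 1))"
      unfolding \<mu>_int[OF abs_meas[OF g]]
      by (intro suminf_le mult_left_mono dual g le P summableI) auto
    also have "\<dots> = ennreal \<kappa>" by (simp only: ennreal_suminf_multc weights mult_1_right ennreal_1 mult_1_left)
    finally show ?thesis .
  qed
  have infty: "(\<integral>\<^sup>+\<omega>. ennreal \<bar>f \<omega>\<bar> \<partial>\<mu>) = \<infinity>"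
  proof -
    \<comment> \<open>Component \<open>k\<close> alone contributes at least
      \<open>(1/2) ^ Suc k\<close> times \<open>\<kappa> * 4 ^ k\<close>, which is unbounded in
      \<open>k\<close>.\<close>
    have "ennreal (\<kappa> / 2 * 2 ^ k) \<le> (\<integral>\<^sup>+\<omega>. ennreal \<bar>f \<omega>\<bar> \<partial>\<mu>)" for k
    proof -
      have "\<kappa> / 2 * 2 ^ k = (1/2) ^ Suc k * (\<kappa> * 4 ^ k)"
        by (simp add: power_mult_distrib[symmetric])
      then have "ennreal (\<kappa> / 2 * 2 ^ k) = ennreal ((1/2) ^ Suc k * (\<kappa> * 4 ^ k))"
        by (rule arg_cong)
      also have "\<dots> = ennreal ((1/2) ^ Suc k) * (ennreal \<kappa> * ennreal (4 ^ k))"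
        using \<kappa> by (subst ennreal_mult, simp, simp, subst ennreal_mult) auto
      also have "\<dots> = ennreal ((1/2) ^ Suc k) * (ennreal \<kappa> * 4 ^ k)"
        using ennreal_power[of 4 k] by simp
      also have "\<dots> \<le> ennreal ((1/2) ^ Suc k) * (ennreal \<kappa> * (\<integral>\<^sup>+\<omega>. u k \<omega> * ennreal \<bar>f \<omega>\<bar> \<partial>P k))"
        by (intro mult_left_mono large) auto
      also have "\<dots> \<le> (\<integral>\<^sup>+\<omega>. ennreal \<bar>f \<omega>\<bar> \<partial>\<mu>)"
        unfolding \<mu>_int[OF abs_meas[OF f]]
        using sum_le_suminf[OF summableI, of "{k}"
          "\<lambda>k. ennreal ((1/2) ^ Suc k) * (ennreal \<kappa> * (\<integral>\<^sup>+\<omega>. u k \<omega> * ennreal \<bar>f \<omega>\<bar> \<partial>P k))"]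
        by simp
      finally show ?thesis .
    qed
    moreover have "\<exists>k. r < \<kappa> / 2 * 2 ^ k" for r :: real
      using real_arch_pow[of 2 "r / (\<kappa> / 2)"] \<kappa> by (auto simp: field_simps)
    ultimately show ?thesis
      by (cases "\<integral>\<^sup>+\<omega>. ennreal \<bar>f \<omega>\<bar> \<partial>\<mu>")
        (auto, metis ennreal_le_iff linorder_not_less)
  qed
  define m where "m = emeasure \<mu> (space \<mu>)"
  \<comment> \<open>Testing with the constant \<kappa>, a member of the modular unit ball, shows
    that the total mass is finite.\<close>
  have "(\<integral>\<^sup>+\<omega>. ennreal \<bar>\<kappa>\<bar> \<partial>\<mu>) \<le> ennreal \<kappa>"
    using \<kappa> prob_space.emeasure_space_1[OF prob] by (intro ball) auto
  then have "ennreal \<kappa> * m \<le> ennreal \<kappa>" using \<kappa> by (simp add: m_def)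
  then have "m \<noteq> \<infinity>" using \<kappa> by (auto simp: ennreal_mult_top top_unique)
  have "m \<noteq> 0"
  proof
    assume "m = 0"
    then have "AE \<omega> in \<mu>. ennreal \<bar>f \<omega>\<bar> = 0"
      by (intro AE_I[of _ _ "space \<mu>"]) (auto simp: m_def)
    then have "(\<integral>\<^sup>+\<omega>. ennreal \<bar>f \<omega>\<bar> \<partial>\<mu>) = (\<integral>\<^sup>+\<omega>. 0 \<partial>\<mu>)"
      by (rule nn_integral_cong_AE)
    then show False using infty by simp
  qed
  define Q where "Q = density \<mu> (\<lambda>_. inverse m)"
  have Q_int: "(\<integral>\<^sup>+\<omega>. h \<omega> \<partial>Q) = inverse m * (\<integral>\<^sup>+\<omega>. h \<omega> \<partial>\<mu>)" if "h \<in> borel_measurable M" for h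
    using that by (simp add: Q_def nn_integral_density nn_integral_cmult \<mu>_meas)
  have inv: "inverse m \<noteq> 0" "inverse m \<noteq> \<infinity>"
    using \<open>m \<noteq> 0\<close> \<open>m \<noteq> \<infinity>\<close> by (auto simp: ennreal_inverse_eq_0_iff)
  have "Q \<in> ca_plus_1 M \<PP> \<Phi>"
  proof (rule ca_plus_1I)
    have "emeasure Q (space Q) = inverse m * m"
      by (simp add: Q_def emeasure_density m_def nn_integral_cmult_indicator)
    also have "\<dots> = 1"
      using \<open>m \<noteq> 0\<close> \<open>m \<noteq> \<infinity>\<close> ennreal_divide_self[of m]
      by (simp add: divide_ennreal_def mult.commute less_top)
    finally show "Q \<in> space (prob_algebra M)"
      by (simp add: space_prob_algebra Q_def \<mu>_sets prob_spaceI)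
    \<comment> \<open>The bound \<kappa> for \<mu>, divided by the mass removed in passing to
      \<open>Q\<close>.\<close>
    show "0 \<le> enn2real (inverse m * ennreal \<kappa>)" by simp
    fix g assume g: "g \<in> borel_measurable M" and le: "\<And>P. P \<in> \<PP> \<Longrightarrow> (\<integral>\<^sup>+\<omega>. \<Phi> P \<bar>g \<omega>\<bar> \<partial>P) \<le> 1"
    have "(\<integral>\<^sup>+\<omega>. ennreal \<bar>g \<omega>\<bar> \<partial>Q) = inverse m * (\<integral>\<^sup>+\<omega>. ennreal \<bar>g \<omega>\<bar> \<partial>\<mu>)"
      using g by (intro Q_int) measurable
    also have "\<dots> \<le> inverse m * ennreal \<kappa>"
      using ball[OF g le] by (intro mult_left_mono) auto
    also have "\<dots> = ennreal (enn2real (inverse m * ennreal \<kappa>))"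
    proof -
      have "inverse m < top" using inv(2) by (simp only: less_top infinity_ennreal_def)
      then show ?thesis by (intro ennreal_enn2real[symmetric]) (simp only: ennreal_mult_less_top ennreal_less_top simp_thms)
    qed
    finally show "(\<integral>\<^sup>+\<omega>. ennreal \<bar>g \<omega>\<bar> \<partial>Q) \<le> \<dots>" .
  qed
  moreover have "(\<integral>\<^sup>+\<omega>. ennreal \<bar>f \<omega>\<bar> \<partial>Q) = \<infinity>"
    using inv infty f by (subst Q_int) (auto simp: ennreal_mult_top)
  ultimately show ?thesis by blast
qed

section \<open>Null sets and integrability under members of \<open>ca_plus_1\<close>\<close>

lemma ca_plus_1_subset: "ca_plus_1 M \<PP> \<Phi> \<subseteq> space (prob_algebra M)"
  by (auto simp: ca_plus_1_def)

lemma variation_ca_plus_1: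
  assumes "Q \<in> ca_plus_1 M \<PP> \<Phi>"
  shows "variation M (measure Q) = Q"
  using assms by (auto simp: ca_plus_1_def space_prob_algebra prob_space_def intro: variation_measure)

lemma ca_plus_1_null:
  assumes Q: "Q \<in> ca_plus_1 M \<PP> \<Phi>" and N: "N \<in> sets M" "(SUP P\<in>\<PP>. emeasure P N) = 0"
  shows "emeasure Q N = 0"
proof -
  have "measure Q \<in> ca M \<PP>" using Q by (simp add: ca_plus_1_def ca_L_Phi_def)
  then show ?thesis
    unfolding ca_def mem_Collect_eq variation_ca_plus_1[OF Q] using N by blast
qed

lemma ca_plus_1_integrable:
  assumes Q: "Q \<in> ca_plus_1 M \<PP> \<Phi>" and X: "X \<in> L_Phi M \<PP> \<Phi>" "f \<in> X"
  shows "integrable Q f"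
proof -
  have "measure Q \<in> ca_L_Phi M \<PP> \<Phi>" using Q by (simp add: ca_plus_1_def)
  then show ?thesis
    unfolding ca_L_Phi_def mem_Collect_eq variation_ca_plus_1[OF Q] using X by blast
qed

subsection \<open>Representations\<close>

text \<open>The set \<open>ca_plus_1\<close> contains \<open>\<PP>\<close>, and its members charge
  no set that is null for all of \<open>\<PP>\<close>, so both families have the same null sets.
  With the identity as Orlicz function, \<open>frak_L\<close> asks for integrability under every
  member; this holds on \<open>L_Phi\<close>, and a function of infinite norm violates it for some
  member.\<close>

lemma represents_ca_plus_1:
  assumes "Linf M \<PP> \<subseteq> L_Phi M \<PP> \<Phi>"
  shows "represents_L_Phi M \<PP> \<Phi> (ca_plus_1 M \<PP> \<Phi>) (\<lambda>_. ennreal)"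
proof -
  let ?R = "ca_plus_1 M \<PP> \<Phi>"
  obtain \<kappa> where \<kappa>: "0 < \<kappa>" "\<And>P. P \<in> \<PP> \<Longrightarrow> \<Phi> P \<kappa> \<le> 1"
    using assms unfolding Linf_subset_L_Phi_iff by blast
  have sub: "\<PP> \<subseteq> ?R" using in_ca_plus_1 by blast
  have equiv: "equiv_measures M ?R \<PP>"
    unfolding equiv_measures_def
  proof (intro ballI iffI)
    fix N assume "(SUP Q\<in>?R. emeasure Q N) = 0"
    moreover have "(SUP P\<in>\<PP>. emeasure P N) \<le> (SUP Q\<in>?R. emeasure Q N)"
      using sub by (rule SUP_subset_mono) simp
    ultimately show "(SUP P\<in>\<PP>. emeasure P N) = 0" by simp
  next
    fix N assume "N \<in> sets M" "(SUP P\<in>\<PP>. emeasure P N) = 0"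
    then have "(SUP Q\<in>?R. emeasure Q N) \<le> 0" by (intro SUP_least) (simp add: ca_plus_1_null)
    then show "(SUP Q\<in>?R. emeasure Q N) = 0" by simp
  qed
  have L0: "L0 M ?R = L0 M \<PP>" using equiv ca_plus_1_subset prob_algebra by (rule L0_cong)
  have "L_Phi M \<PP> \<Phi> = frak_L M ?R (\<lambda>_. ennreal)"
  proof (intro Set.set_eqI iffI)
    fix X assume X: "X \<in> L_Phi M \<PP> \<Phi>"
    have "(\<integral>\<^sup>+\<omega>. ennreal (1 * \<bar>f \<omega>\<bar>) \<partial>Q) < \<infinity>" if "f \<in> X" "Q \<in> ?R" for f Q
      using ca_plus_1_integrable[OF that(2) X that(1)] by (simp add: integrable_iff_bounded)
    then have "\<forall>f\<in>X. \<forall>Q\<in>?R. \<exists>\<alpha>>0. (\<integral>\<^sup>+\<omega>. ennreal (\<alpha> * \<bar>f \<omega>\<bar>) \<partial>Q) < \<infinity>"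
      by (meson zero_less_one)
    then show "X \<in> frak_L M ?R (\<lambda>_. ennreal)" using X by (simp add: frak_L_def L0 L_Phi_def)
  next
    fix X assume X: "X \<in> frak_L M ?R (\<lambda>_. ennreal)"
    then have X0: "X \<in> L0 M \<PP>" by (simp add: frak_L_def L0)
    have "orlicz_norm \<PP> \<Phi> f < \<infinity>" if f: "f \<in> X" for f
    proof (rule ccontr)
      assume "\<not> orlicz_norm \<PP> \<Phi> f < \<infinity>"
      then obtain Q where Q: "Q \<in> ?R" "(\<integral>\<^sup>+\<omega>. ennreal \<bar>f \<omega>\<bar> \<partial>Q) = \<infinity>"
        using exists_ca_plus_1_infinite_integral[OF \<kappa> L0_borel_measurable[OF X0 f]] by blast
      obtain \<alpha> where \<alpha>: "0 < \<alpha>" "(\<integral>\<^sup>+\<omega>. ennreal (\<alpha> * \<bar>f \<omega>\<bar>) \<partial>Q) < \<infinity>"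
        using X f Q(1) by (auto simp: frak_L_def)
      have "sets Q = sets M" using Q(1) ca_plus_1_subset by (auto simp: space_prob_algebra)
      then have [measurable]: "f \<in> borel_measurable Q"
        using L0_borel_measurable[OF X0 f] measurable_cong_sets by blast
      have "(\<integral>\<^sup>+\<omega>. ennreal (\<alpha> * \<bar>f \<omega>\<bar>) \<partial>Q) = ennreal \<alpha> * (\<integral>\<^sup>+\<omega>. ennreal \<bar>f \<omega>\<bar> \<partial>Q)"
        using \<alpha>(1) by (simp add: ennreal_mult nn_integral_cmult)
      then show False using \<alpha> Q(2) by (simp add: ennreal_mult_top)
    qed
    then show "X \<in> L_Phi M \<PP> \<Phi>" using X0 by (simp add: L_Phi_def)
  qed
  then show ?thesis
    using sub nonempty equiv orlicz_function_ennreal by (auto simp: represents_L_Phi_def)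
qed

text \<open>A bounded function can be scaled below a point where \<open>\<Psi> Q\<close> is at most
  1. That point may vary with \<open>Q\<close>, just as \<alpha> does in \<open>frak_L\<close>, so
  bounded functions lie in \<open>frak_L\<close>, which is \<open>L_Phi\<close> by
  assumption.\<close>

lemma represents_imp_Linf_subset:
  assumes "represents_L_Phi M \<PP> \<Phi> \<RR> \<Psi>"
  shows "Linf M \<PP> \<subseteq> L_Phi M \<PP> \<Phi>"
proof
  fix X assume "X \<in> Linf M \<PP>"
  then obtain f c where X: "X \<in> L0 M \<PP>" and f: "f \<in> X" "\<And>\<omega>. \<omega> \<in> space M \<Longrightarrow> \<bar>f \<omega>\<bar> \<le> c"
    by (auto simp: Linf_def)
  have R: "\<RR> \<subseteq> space (prob_algebra M)"
    using assms ca_plus_1_subset by (auto simp: represents_L_Phi_def)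
  have L0: "L0 M \<RR> = L0 M \<PP>"
    using assms R prob_algebra by (intro L0_cong) (auto simp: represents_L_Phi_def)
  have XR: "X \<in> L0 M \<RR>" using X by (simp add: L0)
  have "\<exists>\<alpha>>0. (\<integral>\<^sup>+\<omega>. \<Psi> Q (\<alpha> * \<bar>h \<omega>\<bar>) \<partial>Q) < \<infinity>" if h: "h \<in> X" and Q: "Q \<in> \<RR>" for h Q
  proof -
    interpret prob_space Q using Q R by (auto simp: space_prob_algebra)
    have sets: "sets Q = sets M" using Q R by (auto simp: space_prob_algebra)
    have \<psi>: "orlicz_function (\<Psi> Q)" using assms Q by (simp add: represents_L_Phi_def)
    obtain \<kappa> where \<kappa>: "0 < \<kappa>" "\<Psi> Q \<kappa> \<le> 1" using orlicz_le_1[OF \<psi>] by blast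
    have "AE \<omega> in Q. \<Psi> Q (\<kappa> / max c 1 * \<bar>h \<omega>\<bar>) \<le> 1"
      using L0_AE_eq[OF R XR f(1) h Q] AE_space
    proof eventually_elim
      case (elim \<omega>)
      then have "\<bar>h \<omega>\<bar> \<le> max c 1" using f(2)[of \<omega>] sets_eq_imp_space_eq[OF sets] by auto
      then have "\<kappa> / max c 1 * \<bar>h \<omega>\<bar> \<le> \<kappa>" using \<kappa>(1) by (simp add: field_simps)
      then have "\<Psi> Q (\<kappa> / max c 1 * \<bar>h \<omega>\<bar>) \<le> \<Psi> Q \<kappa>"
        using \<kappa>(1) by (intro orlicz_mono[OF \<psi>]) auto
      then show ?case using \<kappa>(2) by (rule order_trans)
    qed
    then have "(\<integral>\<^sup>+\<omega>. \<Psi> Q (\<kappa> / max c 1 * \<bar>h \<omega>\<bar>) \<partial>Q) \<le> (\<integral>\<^sup>+\<omega>. 1 \<partial>Q)"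
      by (rule nn_integral_mono_AE)
    also have "\<dots> < \<infinity>" by (simp add: emeasure_space_1)
    finally show ?thesis using \<kappa>(1) by (intro exI[of _ "\<kappa> / max c 1"]) simp
  qed
  then have "X \<in> frak_L M \<RR> \<Psi>" using XR by (simp add: frak_L_def)
  then show "X \<in> L_Phi M \<PP> \<Phi>" using assms by (simp add: represents_L_Phi_def)
qed

section \<open>The countably convex case\<close>

lemma phi_Max_upper: "P \<in> \<PP> \<Longrightarrow> \<Phi> P x \<le> phi_Max \<PP> \<Phi> x"
  by (auto simp: phi_Max_def intro: SUP_upper)

text \<open>At \<open>\<kappa> / c P\<close> the domination bounds the supremum by
  \<open>\<Phi> P \<kappa>\<close>, so a single member controls it.\<close>

lemma phi_Max_le_1:
  assumes c: "\<And>P. P \<in> \<PP> \<Longrightarrow> 0 < c P"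
    and le: "\<And>x P. 0 \<le> x \<Longrightarrow> P \<in> \<PP> \<Longrightarrow> phi_Max \<PP> \<Phi> x \<le> \<Phi> P (c P * x)"
  obtains \<kappa> where "0 < \<kappa>" "phi_Max \<PP> \<Phi> \<kappa> \<le> 1"
proof -
  obtain P where P: "P \<in> \<PP>" using nonempty by blast
  obtain \<kappa> where \<kappa>: "0 < \<kappa>" "\<Phi> P \<kappa> \<le> 1" using orlicz_le_1[OF orlicz[OF P]] by blast
  have "phi_Max \<PP> \<Phi> (\<kappa> / c P) \<le> 1"
    using le[of "\<kappa> / c P" P] \<kappa> c[OF P] P by (simp add: order_trans)
  then show thesis using that[of "\<kappa> / c P"] \<kappa> c[OF P] by simp
qed

text \<open>The mixture \<open>Q\<close> belongs to \<open>\<PP>\<close>, so \<open>frak_L\<close>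
  supplies an \<alpha> for it, and the domination by \<open>\<Phi> Q\<close> controls every
  \<open>\<Phi> (P k)\<close> at one common scale.\<close>

lemma frak_L_subset_L_Phi:
  assumes conv: "countably_convex M \<PP>"
    and c: "\<And>P. P \<in> \<PP> \<Longrightarrow> 0 < c P"
    and le: "\<And>x P. 0 \<le> x \<Longrightarrow> P \<in> \<PP> \<Longrightarrow> phi_Max \<PP> \<Phi> x \<le> \<Phi> P (c P * x)"
  shows "frak_L M \<PP> \<Phi> \<subseteq> L_Phi M \<PP> \<Phi>"
proof
  fix X assume X: "X \<in> frak_L M \<PP> \<Phi>"
  then have X0: "X \<in> L0 M \<PP>" by (simp add: frak_L_def)
  have "orlicz_norm \<PP> \<Phi> f < \<infinity>" if f: "f \<in> X" for f
  proof (rule ccontr)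
    assume infinite: "\<not> orlicz_norm \<PP> \<Phi> f < \<infinity>"
    have "\<exists>P\<in>\<PP>. 1 < (\<integral>\<^sup>+\<omega>. \<Phi> P (inverse (4 ^ k) * \<bar>f \<omega>\<bar>) \<partial>P)" for k :: nat
      using infinite unfolding orlicz_norm_finite_iff by (auto simp: not_le dest!: spec[of _ "4 ^ k"])
    then obtain P where P: "P k \<in> \<PP>" and
      gt: "1 < (\<integral>\<^sup>+\<omega>. \<Phi> (P k) (inverse (4 ^ k) * \<bar>f \<omega>\<bar>) \<partial>P k)" for k :: nat
      by metis
    define Q where "Q = mixture M (\<lambda>k. (1/2) ^ Suc k) P"
    have Q: "Q \<in> \<PP>"
      unfolding Q_def
    proof (rule conv[unfolded countably_convex_def, rule_format])
      show "range P \<subseteq> \<PP>" using P by blast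
      show "(\<lambda>k. (1/2 :: real) ^ Suc k) sums 1" by (rule power_half_series)
    qed simp
    obtain \<alpha> where \<alpha>: "0 < \<alpha>" "(\<integral>\<^sup>+\<omega>. \<Phi> Q (\<alpha> * \<bar>f \<omega>\<bar>) \<partial>Q) < \<infinity>"
      using X f Q by (auto simp: frak_L_def)
    define S where "S = enn2real (\<integral>\<^sup>+\<omega>. \<Phi> Q (\<alpha> * \<bar>f \<omega>\<bar>) \<partial>Q)"
    have S: "(\<integral>\<^sup>+\<omega>. \<Phi> Q (\<alpha> * \<bar>f \<omega>\<bar>) \<partial>Q) = ennreal S" "0 \<le> S"
      using \<alpha>(2) by (simp_all add: S_def)
    \<comment> \<open>Dividing by \<open>c Q\<close> absorbs the constant in the domination, so that
      \<open>\<Phi> P\<close> at \<open>\<beta> * z\<close> is at most \<open>\<Phi> Q\<close> at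
      \<open>\<alpha> * z\<close> for every \<open>P\<close> in the family.\<close>
    define \<beta> where "\<beta> = \<alpha> / c Q"
    have \<beta>: "0 < \<beta>" using \<alpha> c[OF Q] by (simp add: \<beta>_def)
    have \<Phi>_le: "\<Phi> P (\<beta> * \<bar>f \<omega>\<bar>) \<le> \<Phi> Q (\<alpha> * \<bar>f \<omega>\<bar>)" if "P \<in> \<PP>" for P \<omega>
    proof -
      have "\<Phi> P (\<beta> * \<bar>f \<omega>\<bar>) \<le> phi_Max \<PP> \<Phi> (\<beta> * \<bar>f \<omega>\<bar>)" using that by (rule phi_Max_upper)
      also have "\<dots> \<le> \<Phi> Q (c Q * (\<beta> * \<bar>f \<omega>\<bar>))" using \<beta> Q by (intro le) auto
      also have "c Q * (\<beta> * \<bar>f \<omega>\<bar>) = \<alpha> * \<bar>f \<omega>\<bar>" using c[OF Q] by (simp add: \<beta>_def)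
      finally show ?thesis .
    qed
    have \<Phi>_meas: "(\<lambda>\<omega>. \<Phi> P (r * \<bar>f \<omega>\<bar>)) \<in> borel_measurable M" if "P \<in> \<PP>" "0 < r" for P r
    proof -
      have "(\<lambda>\<omega>. r * f \<omega>) \<in> borel_measurable M"
        using L0_borel_measurable[OF X0 f] by simp
      from measurable_compose[OF this borel_measurable_orlicz[OF orlicz[OF that(1)]]] that(2)
      show ?thesis by (simp add: abs_mult)
    qed
    have sub: "P k \<in> space (subprob_algebra M)" for k
      by (simp add: space_subprob_algebra sets_eq P prob prob_space_imp_subprob_space)
    \<comment> \<open>\<open>P k\<close> enters \<open>Q\<close> with weight
      \<open>(1/2) ^ Suc k\<close>, so nonnegative integrals against it are at most
      \<open>2 ^ Suc k\<close> times those against \<open>Q\<close>.\<close>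
    have bound: "(\<integral>\<^sup>+\<omega>. \<Phi> (P k) (\<beta> * \<bar>f \<omega>\<bar>) \<partial>P k) \<le> ennreal (2 ^ Suc k * S)" for k
    proof -
      have "ennreal ((1/2) ^ Suc k) * (\<integral>\<^sup>+\<omega>. \<Phi> Q (\<alpha> * \<bar>f \<omega>\<bar>) \<partial>P k) \<le>
          (\<Sum>k. ennreal ((1/2) ^ Suc k) * (\<integral>\<^sup>+\<omega>. \<Phi> Q (\<alpha> * \<bar>f \<omega>\<bar>) \<partial>P k))"
        using sum_le_suminf[OF summableI, of "{k}"
          "\<lambda>k. ennreal ((1/2) ^ Suc k) * (\<integral>\<^sup>+\<omega>. \<Phi> Q (\<alpha> * \<bar>f \<omega>\<bar>) \<partial>P k)"] by simp
      also have "\<dots> = (\<integral>\<^sup>+\<omega>. \<Phi> Q (\<alpha> * \<bar>f \<omega>\<bar>) \<partial>Q)"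
        unfolding Q_def
        by (rule nn_integral_mixture[OF sub \<Phi>_meas[OF Q[unfolded Q_def] \<alpha>(1)], symmetric])
      also have "\<dots> = ennreal S" by (rule S)
      finally have le_S: "ennreal ((1/2) ^ Suc k) * (\<integral>\<^sup>+\<omega>. \<Phi> Q (\<alpha> * \<bar>f \<omega>\<bar>) \<partial>P k) \<le> ennreal S" .
      have one: "ennreal (2 ^ Suc k) * ennreal ((1/2) ^ Suc k) = 1"
      proof -
        have "ennreal (2 ^ Suc k) * ennreal ((1/2) ^ Suc k) = ennreal (2 ^ Suc k * (1/2) ^ Suc k)"
          by (rule ennreal_mult[symmetric]) simp_all
        also have "2 ^ Suc k * (1/2 :: real) ^ Suc k = 1" by (simp add: power_mult_distrib[symmetric] del: power_Suc)
        finally show ?thesis by simp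
      qed
      have "(\<integral>\<^sup>+\<omega>. \<Phi> (P k) (\<beta> * \<bar>f \<omega>\<bar>) \<partial>P k) \<le> (\<integral>\<^sup>+\<omega>. \<Phi> Q (\<alpha> * \<bar>f \<omega>\<bar>) \<partial>P k)"
        by (intro nn_integral_mono \<Phi>_le P)
      also have "\<dots> = ennreal (2 ^ Suc k) * (ennreal ((1/2) ^ Suc k) * (\<integral>\<^sup>+\<omega>. \<Phi> Q (\<alpha> * \<bar>f \<omega>\<bar>) \<partial>P k))"
        by (simp only: mult.assoc[symmetric] one mult_1_left)
      also have "\<dots> \<le> ennreal (2 ^ Suc k) * ennreal S"
        using le_S by (rule mult_left_mono) simp
      also have "\<dots> = ennreal (2 ^ Suc k * S)" using S(2) by (intro ennreal_mult[symmetric]) simp_all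
      finally show ?thesis .
    qed
    \<comment> \<open>Large enough for two purposes: \<open>1 / \<beta>\<close> at most
      \<open>4 ^ k\<close>, which gives \<open>t \<le> 1\<close>, and \<open>2 * S / \<beta>\<close>
      at most \<open>2 ^ k\<close>, which brings the scaled integral down to 1.\<close>
    obtain k :: nat where k: "2 * (1 + S) * (1 + 1 / \<beta>) < 2 ^ k"
      using real_arch_pow[of 2 "2 * (1 + S) * (1 + 1 / \<beta>)"] by auto
    \<comment> \<open>The ratio of the scale \<open>inverse (4 ^ k)\<close> to \<beta>, to be pulled
      out of \<open>\<Phi> (P k)\<close> by convexity.\<close>
    define t where "t = inverse (4 ^ k) / \<beta>"
    have t0: "0 < t" using \<beta> by (simp add: t_def)
    have "t * (2 ^ Suc k * S) = 2 * S * (1 / \<beta>) / 2 ^ k"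
    proof -
      have "(4::real) ^ k = 2 ^ k * 2 ^ k" by (simp add: power_mult_distrib[symmetric])
      then show ?thesis using \<beta> by (simp add: t_def field_simps)
    qed
    also have "\<dots> \<le> 1"
    proof -
      have "2 * S * (1 / \<beta>) \<le> 2 * (1 + S) * (1 + 1 / \<beta>)"
        using S(2) \<beta> by (intro mult_mono) auto
      then have "2 * S * (1 / \<beta>) \<le> 2 ^ k" using less_imp_le[OF k] by (rule order_trans)
      then show ?thesis by (subst divide_le_eq_1_pos) simp_all
    qed
    finally have tS: "t * (2 ^ Suc k * S) \<le> 1" .
    have t1: "t \<le> 1"
    proof -
      have "1 * (1 / \<beta>) \<le> 2 * (1 + S) * (1 + 1 / \<beta>)"
        using S(2) \<beta> by (intro mult_mono) auto
      then have "1 * (1 / \<beta>) \<le> 2 ^ k" using less_imp_le[OF k] by (rule order_trans)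
      then have "1 / \<beta> \<le> 2 ^ k" by simp
      also have "\<dots> \<le> 4 ^ k" by (rule power_mono) simp_all
      finally show ?thesis using \<beta> by (simp add: t_def field_simps)
    qed
    have "(\<integral>\<^sup>+\<omega>. \<Phi> (P k) (inverse (4 ^ k) * \<bar>f \<omega>\<bar>) \<partial>P k) =
        (\<integral>\<^sup>+\<omega>. \<Phi> (P k) (t * (\<beta> * \<bar>f \<omega>\<bar>)) \<partial>P k)"
      using \<beta> by (simp add: t_def)
    also have "\<dots> \<le> (\<integral>\<^sup>+\<omega>. ennreal t * \<Phi> (P k) (\<beta> * \<bar>f \<omega>\<bar>) \<partial>P k)"
      using t0 t1 \<beta> by (intro nn_integral_mono orlicz_scale orlicz P) auto
    also have "\<dots> = ennreal t * (\<integral>\<^sup>+\<omega>. \<Phi> (P k) (\<beta> * \<bar>f \<omega>\<bar>) \<partial>P k)"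
      using \<Phi>_meas[OF P \<beta>] measurable_cong_sets[OF sets_eq[OF P] refl]
      by (intro nn_integral_cmult) blast
    also have "\<dots> \<le> ennreal t * ennreal (2 ^ Suc k * S)"
      using bound by (rule mult_left_mono) simp
    also have "\<dots> = ennreal (t * (2 ^ Suc k * S))"
      using t0 S(2) by (intro ennreal_mult[symmetric]) auto
    also have "\<dots> \<le> 1" using tS by (simp add: ennreal_le_1 del: power_Suc)
    finally show False using gt[of k] by simp
  qed
  then show "X \<in> L_Phi M \<PP> \<Phi>" using X0 by (simp add: L_Phi_def)
qed

text \<open>The inclusions form a cycle from \<open>L_Phi\<close> through \<open>frak_L\<close> with
  \<open>phi_Max\<close> and \<open>frak_L\<close> with \<Phi> back to \<open>L_Phi\<close>, so all
  three spaces coincide.\<close>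

lemma represents_countably_convex:
  assumes conv: "countably_convex M \<PP>"
    and c: "\<And>P. P \<in> \<PP> \<Longrightarrow> 0 < c P"
    and le: "\<And>x P. 0 \<le> x \<Longrightarrow> P \<in> \<PP> \<Longrightarrow> phi_Max \<PP> \<Phi> x \<le> \<Phi> P (c P * x)"
  shows "represents_L_Phi M \<PP> \<Phi> \<PP> \<Phi>" "represents_L_Phi M \<PP> \<Phi> \<PP> (\<lambda>_. phi_Max \<PP> \<Phi>)"
proof -
  have sub1: "L_Phi M \<PP> \<Phi> \<subseteq> frak_L M \<PP> (\<lambda>_. phi_Max \<PP> \<Phi>)"
  proof
    fix X assume X: "X \<in> L_Phi M \<PP> \<Phi>"
    have "\<exists>\<alpha>>0. (\<integral>\<^sup>+\<omega>. phi_Max \<PP> \<Phi> (\<alpha> * \<bar>f \<omega>\<bar>) \<partial>P) < \<infinity>" if f: "f \<in> X" and P: "P \<in> \<PP>" for f P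
    proof -
      have "orlicz_norm \<PP> \<Phi> f < \<infinity>" using X f by (simp add: L_Phi_def)
      then obtain l where l: "0 < l" "(\<integral>\<^sup>+\<omega>. \<Phi> P (inverse l * \<bar>f \<omega>\<bar>) \<partial>P) \<le> 1"
        using P unfolding orlicz_norm_finite_iff by blast
      \<comment> \<open>Shrinking the scale by \<open>c P\<close> trades \<open>\<Phi> P\<close> for
        the supremum.\<close>
      have "phi_Max \<PP> \<Phi> (inverse l / c P * \<bar>f \<omega>\<bar>) \<le> \<Phi> P (inverse l * \<bar>f \<omega>\<bar>)" for \<omega>
        using le[of "inverse l / c P * \<bar>f \<omega>\<bar>" P] l(1) c[OF P] P by simp
      then have "(\<integral>\<^sup>+\<omega>. phi_Max \<PP> \<Phi> (inverse l / c P * \<bar>f \<omega>\<bar>) \<partial>P) \<le> (\<integral>\<^sup>+\<omega>. \<Phi> P (inverse l * \<bar>f \<omega>\<bar>) \<partial>P)"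
        by (rule nn_integral_mono)
      also have "\<dots> \<le> 1" by (rule l)
      also have "\<dots> < (\<infinity> :: ennreal)" by simp
      finally show ?thesis using l(1) c[OF P] by (intro exI[of _ "inverse l / c P"]) simp
    qed
    then show "X \<in> frak_L M \<PP> (\<lambda>_. phi_Max \<PP> \<Phi>)" using X by (simp add: frak_L_def L_Phi_def)
  qed
  have sub2: "frak_L M \<PP> (\<lambda>_. phi_Max \<PP> \<Phi>) \<subseteq> frak_L M \<PP> \<Phi>"
  proof
    fix X assume X: "X \<in> frak_L M \<PP> (\<lambda>_. phi_Max \<PP> \<Phi>)"
    have "\<exists>\<alpha>>0. (\<integral>\<^sup>+\<omega>. \<Phi> P (\<alpha> * \<bar>f \<omega>\<bar>) \<partial>P) < \<infinity>" if f: "f \<in> X" and P: "P \<in> \<PP>" for f P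
    proof -
      obtain \<alpha> where "0 < \<alpha>" "(\<integral>\<^sup>+\<omega>. phi_Max \<PP> \<Phi> (\<alpha> * \<bar>f \<omega>\<bar>) \<partial>P) < \<infinity>"
        using X f P by (auto simp: frak_L_def)
      moreover have "(\<integral>\<^sup>+\<omega>. \<Phi> P (\<alpha> * \<bar>f \<omega>\<bar>) \<partial>P) \<le> (\<integral>\<^sup>+\<omega>. phi_Max \<PP> \<Phi> (\<alpha> * \<bar>f \<omega>\<bar>) \<partial>P)"
        by (intro nn_integral_mono phi_Max_upper P)
      ultimately show ?thesis by (meson le_less_trans)
    qed
    then show "X \<in> frak_L M \<PP> \<Phi>" using X by (simp add: frak_L_def)
  qed
  have sub3: "frak_L M \<PP> \<Phi> \<subseteq> L_Phi M \<PP> \<Phi>"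
    using conv c le by (rule frak_L_subset_L_Phi)
  \<comment> \<open>This point provides the finiteness that makes \<open>phi_Max\<close> an Orlicz
    function.\<close>
  obtain \<kappa> where \<kappa>: "0 < \<kappa>" "phi_Max \<PP> \<Phi> \<kappa> \<le> 1" using phi_Max_le_1[OF c le] by blast
  then have "phi_Max \<PP> \<Phi> \<kappa> < \<infinity>" using le_less_trans[of _ 1 "\<infinity> :: ennreal"] by simp
  then have "orlicz_function (phi_Max \<PP> \<Phi>)"
    using nonempty orlicz \<kappa>(1) orlicz_function_phi_Max by blast
  then show "represents_L_Phi M \<PP> \<Phi> \<PP> \<Phi>" "represents_L_Phi M \<PP> \<Phi> \<PP> (\<lambda>_. phi_Max \<PP> \<Phi>)"
    using sub1 sub2 sub3 nonempty orlicz in_ca_plus_1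
    by (auto simp: represents_L_Phi_def equiv_measures_def)
qed

end

theorem proposition3p12:
  fixes M :: "'a measure" and \<PP> :: "'a measure set"
    and \<Phi> :: "'a measure \<Rightarrow> real \<Rightarrow> ennreal"
  assumes "\<PP> \<noteq> {}" and "\<PP> \<subseteq> space (prob_algebra M)"
    and "\<forall>P\<in>\<PP>. orlicz_function (\<Phi> P)"
  shows "(Linf M \<PP> \<subseteq> L_Phi M \<PP> \<Phi> \<longleftrightarrow> (\<exists>\<RR> \<Psi>. represents_L_Phi M \<PP> \<Phi> \<RR> \<Psi>)) \<and>
    (countably_convex M \<PP> \<and>
     (\<exists>c :: 'a measure \<Rightarrow> real. (\<forall>P\<in>\<PP>. c P > 0) \<and>
        (\<forall>x\<ge>0. \<forall>P\<in>\<PP>. phi_Max \<PP> \<Phi> x \<le> \<Phi> P (c P * x))) \<longrightarrow>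
     Linf M \<PP> \<subseteq> L_Phi M \<PP> \<Phi> \<and>
     (\<exists>\<RR> \<Psi>. represents_L_Phi M \<PP> \<Phi> \<RR> \<Psi>) \<and>
     represents_L_Phi M \<PP> \<Phi> \<PP> \<Phi> \<and>
     represents_L_Phi M \<PP> \<Phi> \<PP> (\<lambda>_. phi_Max \<PP> \<Phi>))"
proof -
  interpret orlicz_family M \<PP> \<Phi>
    using assms by unfold_locales auto
  have iff: "Linf M \<PP> \<subseteq> L_Phi M \<PP> \<Phi> \<longleftrightarrow> (\<exists>\<RR> \<Psi>. represents_L_Phi M \<PP> \<Phi> \<RR> \<Psi>)"
    using represents_ca_plus_1 represents_imp_Linf_subset by blast
  have "represents_L_Phi M \<PP> \<Phi> \<PP> \<Phi> \<and> represents_L_Phi M \<PP> \<Phi> \<PP> (\<lambda>_. phi_Max \<PP> \<Phi>)"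
    if "countably_convex M \<PP>" "\<forall>P\<in>\<PP>. c P > 0"
      "\<forall>x\<ge>0. \<forall>P\<in>\<PP>. phi_Max \<PP> \<Phi> x \<le> \<Phi> P (c P * x)" for c
    using represents_countably_convex[of c] that by blast
  then show ?thesis using iff by blast
qed

end
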